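(* Let $R$ be a commutative ring with identity, $S$ a multiplicative subset of $R$ with $0\notin S$, and $(M_i)_{i\in I}$ a family of $R$-modules. Then: (1) $\prod_{i\in I}M_i$ is $S$-FP-injective if and only if each $M_i$ is $S$-FP-injective. In particular, every direct summand of an $S$-FP-injective module is $S$-FP-injective. (2) Assume that $R_S$ is finitely presented as an $R$-module. Then $\bigoplus_{i\in I}M_i$ is $S$-FP-injective if and only if each $M_i$ is $S$-FP-injective.
   Context: A multiplicative subset $S$ of $R$ satisfies $1\in S$ and is closed under multiplication. $M_S$ denotes the localization of an $R$-module $M$ at $S$; localizations are regarded as $R$-modules when they appear in $\operatorname{Hom}_R$. An exact sequence of $R$-modules $0\to A\to B\to C\to 0$ is $S$-pure if $0\to\operatorname{Hom}_R(P_S,A)\to\operatorname{Hom}_R(P_S,B)\to\operatorname{Hom}_R(P_S,C)\to0$ is exact for every finitely presented $R$-module $P$. A monomorphism $f:M\to N$ is $S$-pure if $0\to M\to N\to\operatorname{coker}(f)\to0$ is $S$-pure. An $R$-module $M$ is $S$-FP-injective if every monomorphism of $R$-modules $M\to N$ is $S$-pure. *)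

theory Defs
  imports "HOL-Algebra.Module" "HOL-Algebra.AbelCoset"
begin

text \<open>
  The record type of modules extends that of rings, so it has fields \<open>mult\<close> and \<open>one\<close>,
  which play no role in the locale \<open>module\<close>; they are left \<open>undefined\<close> below.
\<close>

definition regular_module :: "('r, 'x) ring_scheme \<Rightarrow> ('r, 'r) module" where
  "regular_module R =
    \<lparr>carrier = carrier R, mult = undefined, one = undefined,
     zero = \<zero>\<^bsub>R\<^esub>, add = add R, smult = mult R\<rparr>"

definition prod_module :: "'i set \<Rightarrow> ('i \<Rightarrow> ('r, 'm) module) \<Rightarrow> ('r, 'i \<Rightarrow> 'm) module" where
  "prod_module I M =
    \<lparr>carrier = (\<Pi>\<^sub>E i\<in>I. carrier (M i)), mult = undefined, one = undefined,
     zero = (\<lambda>i\<in>I. \<zero>\<^bsub>M i\<^esub>),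
     add = (\<lambda>x y. \<lambda>i\<in>I. x i \<oplus>\<^bsub>M i\<^esub> y i),
     smult = (\<lambda>r x. \<lambda>i\<in>I. r \<odot>\<^bsub>M i\<^esub> x i)\<rparr>"

definition sum_module :: "'i set \<Rightarrow> ('i \<Rightarrow> ('r, 'm) module) \<Rightarrow> ('r, 'i \<Rightarrow> 'm) module" where
  "sum_module I M =
    (prod_module I M)
      \<lparr>carrier := {x \<in> carrier (prod_module I M). finite {i \<in> I. x i \<noteq> \<zero>\<^bsub>M i\<^esub>}}\<rparr>"

definition free_module :: "('r, 'x) ring_scheme \<Rightarrow> nat \<Rightarrow> ('r, nat \<Rightarrow> 'r) module" where
  "free_module R n = prod_module {..<n} (\<lambda>_. regular_module R)"

definition mod_hom :: "('r, 'x) ring_scheme \<Rightarrow> ('r, 'a) module \<Rightarrow> ('r, 'b) module \<Rightarrow> ('a \<Rightarrow> 'b) set" where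
  "mod_hom R M N =
    {h \<in> carrier M \<rightarrow> carrier N.
       (\<forall>x\<in>carrier M. \<forall>y\<in>carrier M. h (x \<oplus>\<^bsub>M\<^esub> y) = h x \<oplus>\<^bsub>N\<^esub> h y) \<and>
       (\<forall>r\<in>carrier R. \<forall>x\<in>carrier M. h (r \<odot>\<^bsub>M\<^esub> x) = r \<odot>\<^bsub>N\<^esub> h x)}"

text \<open>
  Functions on \<^term>\<open>carrier M\<close> are represented by HOL functions that are extensional
  on \<^term>\<open>carrier M\<close>, so that equality in the Hom module is equality of maps.
\<close>

definition Hom_module :: "('r, 'x) ring_scheme \<Rightarrow> ('r, 'a) module \<Rightarrow> ('r, 'b) module \<Rightarrow> ('r, 'a \<Rightarrow> 'b) module" where
  "Hom_module R M N =
    \<lparr>carrier = mod_hom R M N \<inter> extensional (carrier M), mult = undefined, one = undefined,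
     zero = (\<lambda>x\<in>carrier M. \<zero>\<^bsub>N\<^esub>),
     add = (\<lambda>g h. \<lambda>x\<in>carrier M. g x \<oplus>\<^bsub>N\<^esub> h x),
     smult = (\<lambda>r h. \<lambda>x\<in>carrier M. r \<odot>\<^bsub>N\<^esub> h x)\<rparr>"

definition short_exact :: "('r, 'x) ring_scheme \<Rightarrow> ('r, 'a) module \<Rightarrow> ('a \<Rightarrow> 'b) \<Rightarrow> ('r, 'b) module
    \<Rightarrow> ('b \<Rightarrow> 'c) \<Rightarrow> ('r, 'c) module \<Rightarrow> bool" where
  "short_exact R A f B g C \<longleftrightarrow>
    module R A \<and> module R B \<and> module R C \<and>
    f \<in> mod_hom R A B \<and> g \<in> mod_hom R B C \<and>
    inj_on f (carrier A) \<and> f ` carrier A = a_kernel B C g \<and> g ` carrier B = carrier C"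

definition quot_module :: "('r, 'a) module \<Rightarrow> 'a set \<Rightarrow> ('r, 'a set) module" where
  "quot_module N K =
    \<lparr>carrier = a_rcosets\<^bsub>N\<^esub> K, mult = undefined, one = undefined,
     zero = K, add = set_add N,
     smult = (\<lambda>r X. \<Union>x\<in>X. K +>\<^bsub>N\<^esub> (r \<odot>\<^bsub>N\<^esub> x))\<rparr>"

definition coker :: "('r, 'a) module \<Rightarrow> ('a \<Rightarrow> 'b) \<Rightarrow> ('r, 'b) module \<Rightarrow> ('r, 'b set) module" where
  "coker M f N = quot_module N (f ` carrier M)"

definition coker_proj :: "('r, 'a) module \<Rightarrow> ('a \<Rightarrow> 'b) \<Rightarrow> ('r, 'b) module \<Rightarrow> 'b \<Rightarrow> 'b set" where
  "coker_proj M f N = (\<lambda>x. f ` carrier M +>\<^bsub>N\<^esub> x)"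

definition finitely_presented :: "('r, 'x) ring_scheme \<Rightarrow> ('r, 'p) module \<Rightarrow> bool" where
  "finitely_presented R P \<longleftrightarrow> module R P \<and>
    (\<exists>m n \<phi> \<psi>. \<phi> \<in> mod_hom R (free_module R m) (free_module R n) \<and>
               \<psi> \<in> mod_hom R (free_module R n) P \<and>
               \<phi> ` carrier (free_module R m) = a_kernel (free_module R n) P \<psi> \<and>
               \<psi> ` carrier (free_module R n) = carrier P)"


text \<open>
  The elements of the localization of \<open>M\<close> at \<open>S\<close> are the equivalence classes \<open>m/s\<close> of pairs,
  where \<open>m/s = n/t\<close> iff \<open>u t m = u s n\<close> for some \<open>u \<in> S\<close>. It is regarded as an \<open>R\<close>-module.
\<close>

definition loc_rel :: "('r, 'x) ring_scheme \<Rightarrow> 'r set \<Rightarrow> ('r, 'm) module \<Rightarrow> (('m \<times> 'r) \<times> ('m \<times> 'r)) set" where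
  "loc_rel R S M =
    {((m, s), (n, t)). m \<in> carrier M \<and> s \<in> S \<and> n \<in> carrier M \<and> t \<in> S \<and>
       (\<exists>u\<in>S. u \<odot>\<^bsub>M\<^esub> (t \<odot>\<^bsub>M\<^esub> m) = u \<odot>\<^bsub>M\<^esub> (s \<odot>\<^bsub>M\<^esub> n))}"

definition loc_frac :: "('r, 'x) ring_scheme \<Rightarrow> 'r set \<Rightarrow> ('r, 'm) module \<Rightarrow> 'm \<Rightarrow> 'r \<Rightarrow> ('m \<times> 'r) set" where
  "loc_frac R S M m s = loc_rel R S M `` {(m, s)}"

definition localization :: "('r, 'x) ring_scheme \<Rightarrow> 'r set \<Rightarrow> ('r, 'm) module \<Rightarrow> ('r, ('m \<times> 'r) set) module" where
  "localization R S M =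
    \<lparr>carrier = (carrier M \<times> S) // loc_rel R S M, mult = undefined, one = undefined,
     zero = loc_frac R S M \<zero>\<^bsub>M\<^esub> \<one>\<^bsub>R\<^esub>,
     add = (\<lambda>X Y. \<Union>(m, s)\<in>X. \<Union>(n, t)\<in>Y.
              loc_frac R S M (t \<odot>\<^bsub>M\<^esub> m \<oplus>\<^bsub>M\<^esub> s \<odot>\<^bsub>M\<^esub> n) (s \<otimes>\<^bsub>R\<^esub> t)),
     smult = (\<lambda>r X. \<Union>(m, s)\<in>X. loc_frac R S M (r \<odot>\<^bsub>M\<^esub> m) s)\<rparr>"


text \<open>
  HOL definitions cannot quantify over types, so each quantifier over all modules below ranges
  over the modules with carrier in one fixed type that is large enough.

  Every finitely presented module is isomorphic to a quotient of some \<^term>\<open>free_module R n\<close>,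
  whose elements are cosets, i.e. sets of functions \<^typ>\<open>nat \<Rightarrow> 'r\<close>. Hence \<open>P\<close> below ranges,
  up to isomorphism, over all finitely presented modules; see \<open>S_pure_exact_any_type\<close> at the end.
\<close>

definition S_pure_exact :: "('r, 'x) ring_scheme \<Rightarrow> 'r set \<Rightarrow> ('r, 'a) module \<Rightarrow> ('a \<Rightarrow> 'b) \<Rightarrow> ('r, 'b) module
    \<Rightarrow> ('b \<Rightarrow> 'c) \<Rightarrow> ('r, 'c) module \<Rightarrow> bool" where
  "S_pure_exact R S A f B g C \<longleftrightarrow> short_exact R A f B g C \<and>
    (\<forall>P :: ('r, (nat \<Rightarrow> 'r) set) module. finitely_presented R P \<longrightarrow>
       short_exact R
         (Hom_module R (localization R S P) A) (compose (carrier (localization R S P)) f)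
         (Hom_module R (localization R S P) B) (compose (carrier (localization R S P)) g)
         (Hom_module R (localization R S P) C))"

definition S_pure_mono :: "('r, 'x) ring_scheme \<Rightarrow> 'r set \<Rightarrow> ('r, 'm) module \<Rightarrow> ('m \<Rightarrow> 'n) \<Rightarrow> ('r, 'n) module \<Rightarrow> bool" where
  "S_pure_mono R S M f N \<longleftrightarrow> S_pure_exact R S M f N (coker_proj M f N) (coker M f N)"

text \<open>
  In the next definition \<open>N\<close> ranges over the modules with carrier in \<^typ>\<open>'m \<times> 'r list\<close>.
  Given a monomorphism from \<open>M\<close> into a module \<open>N\<close> of any type, lifting a fixed map from \<open>P\<^sub>S\<close>
  to the cokernel only involves the preimage \<open>N'\<close> in \<open>N\<close> of the image of that map. An element of
  \<open>N'\<close> is determined by an element of \<open>P\<^sub>S\<close>, i.e. a nonempty list of scalars, and an element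
  of \<open>M\<close>, so \<open>N'\<close> is isomorphic to a module with carrier in this type.
  Accordingly, \<open>S_FP_injective_any_type\<close> at the end proves that every monomorphism from an
  S-FP-injective module into a module of any type is S-pure.
\<close>

definition S_FP_injective :: "('r, 'x) ring_scheme \<Rightarrow> 'r set \<Rightarrow> ('r, 'm) module \<Rightarrow> bool" where
  "S_FP_injective R S M \<longleftrightarrow> module R M \<and>
    (\<forall>(N :: ('r, 'm \<times> 'r list) module) f.
       module R N \<and> f \<in> mod_hom R M N \<and> inj_on f (carrier M) \<longrightarrow> S_pure_mono R S M f N)"


text \<open>
  The remaining lemmas show that the constructions above are modules and that the choice of types
  in \<open>S_pure_exact\<close> and \<open>S_FP_injective\<close> is immaterial.
\<close>

lemma prod_module_module:
  assumes "cring R" "\<And>i. i \<in> I \<Longrightarrow> module R (M i)"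
  shows "module R (prod_module I M)"
proof -
  have ag: "abelian_group (prod_module I M)"
  proof (rule abelian_groupI, goal_cases)
    case (1 x y)
    then show ?case using assms by (auto simp: prod_module_def PiE_iff module_def abelian_group_def intro: abelian_monoid.a_closed)
  next
    case 2
    then show ?case using assms by (auto simp: prod_module_def module_def abelian_group_def intro: abelian_monoid.zero_closed)
  next
    case (3 x y z)
    then show ?case using assms
      by (auto simp: prod_module_def PiE_iff module_def abelian_group_def intro!: restrict_ext abelian_monoid.a_assoc)
  next
    case (4 x y)
    then show ?case using assms
      by (auto simp: prod_module_def PiE_iff module_def abelian_group_def intro!: restrict_ext abelian_monoid.a_comm)
  next
    case (5 x)
    then show ?case using assms
      by (auto simp: prod_module_def PiE_iff module_def abelian_group_def extensional_def abelian_monoid.l_zero)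
  next
    case (6 x)
    have "\<ominus>\<^bsub>M i\<^esub> x i \<in> carrier (M i) \<and> \<ominus>\<^bsub>M i\<^esub> x i \<oplus>\<^bsub>M i\<^esub> x i = \<zero>\<^bsub>M i\<^esub>" if "i \<in> I" for i
      using 6 that assms(2)[OF that]
      by (auto simp: prod_module_def PiE_iff module_def abelian_group.a_inv_closed abelian_group.l_neg)
    then show ?case
      by (intro bexI[of _ "\<lambda>i\<in>I. \<ominus>\<^bsub>M i\<^esub> x i"]) (auto simp: prod_module_def)
  qed
  show ?thesis
    apply (rule moduleI[OF assms(1) ag])
    using assms(2)
    by (auto simp: prod_module_def PiE_iff extensional_def module.smult_closed module.smult_l_distr
        module.smult_r_distr module.smult_assoc1 module.smult_one intro!: restrict_ext module.smult_closed[of R] module.smult_r_distr)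
qed

lemma regular_module_module:
  assumes "cring R" shows "module R (regular_module R)"
proof -
  interpret cring R by fact
  show ?thesis
    apply (rule moduleI[OF assms])
         apply (rule abelian_groupI)
              apply (auto simp: regular_module_def a_ac l_distr r_distr m_assoc)
    done
qed

lemma free_module_module: "cring R \<Longrightarrow> module R (free_module R n)"
  by (simp add: free_module_def prod_module_module regular_module_module)

lemma submodule_sum_module:
  assumes "cring R" "\<And>i. i \<in> I \<Longrightarrow> module R (M i)"
  shows "submodule {x \<in> carrier (prod_module I M). finite {i \<in> I. x i \<noteq> \<zero>\<^bsub>M i\<^esub>}} R (prod_module I M)" (is "submodule ?H _ _")
proof -
  interpret P: module R "prod_module I M" by (rule prod_module_module[OF assms])
  have ag: "abelian_group (M i)" if "i \<in> I" for i using assms that by (auto simp: module_def)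
  have neg: "\<ominus>\<^bsub>prod_module I M\<^esub> a = (\<lambda>i\<in>I. \<ominus>\<^bsub>M i\<^esub> a i)" if "a \<in> carrier (prod_module I M)" for a
  proof (rule P.minus_equality)
    show "(\<lambda>i\<in>I. \<ominus>\<^bsub>M i\<^esub> a i) \<oplus>\<^bsub>prod_module I M\<^esub> a = \<zero>\<^bsub>prod_module I M\<^esub>"
      using that ag by (auto simp: prod_module_def PiE_iff abelian_group.l_neg)
    show "(\<lambda>i\<in>I. \<ominus>\<^bsub>M i\<^esub> a i) \<in> carrier (prod_module I M)"
      using that ag by (auto simp: prod_module_def PiE_iff abelian_group.a_inv_closed)
  qed (use that in auto)
  show ?thesis
  proof (rule P.submoduleI)
    show "?H \<subseteq> carrier (prod_module I M)" by auto
    show "\<zero>\<^bsub>prod_module I M\<^esub> \<in> ?H"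
      using P.zero_closed by (auto simp: prod_module_def cong: conj_cong)
  next
    fix a assume a: "a \<in> ?H"
    have "\<ominus>\<^bsub>M i\<^esub> \<zero>\<^bsub>M i\<^esub> = \<zero>\<^bsub>M i\<^esub>" if "i \<in> I" for i
      using abelian_group.minus_equality[OF ag[OF that]] ag[OF that]
      by (simp add: abelian_group_def abelian_monoid.l_zero abelian_monoid.zero_closed)
    then have "{i \<in> I. \<ominus>\<^bsub>M i\<^esub> a i \<noteq> \<zero>\<^bsub>M i\<^esub>} \<subseteq> {i \<in> I. a i \<noteq> \<zero>\<^bsub>M i\<^esub>}"
      by auto
    with a neg[of a] P.a_inv_closed[of a] show "\<ominus>\<^bsub>prod_module I M\<^esub> a \<in> ?H"
      by (auto intro: finite_subset cong: conj_cong)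
  next
    fix a b assume a: "a \<in> ?H" "b \<in> ?H"
    have "{i \<in> I. (a \<oplus>\<^bsub>prod_module I M\<^esub> b) i \<noteq> \<zero>\<^bsub>M i\<^esub>} \<subseteq> {i \<in> I. a i \<noteq> \<zero>\<^bsub>M i\<^esub>} \<union> {i \<in> I. b i \<noteq> \<zero>\<^bsub>M i\<^esub>}"
      using ag by (auto simp: prod_module_def abelian_group_def abelian_monoid.l_zero abelian_monoid.zero_closed)
    with a show "a \<oplus>\<^bsub>prod_module I M\<^esub> b \<in> ?H"
      using finite_subset by auto
  next
    fix r x assume a: "r \<in> carrier R" "x \<in> ?H"
    have "{i \<in> I. (r \<odot>\<^bsub>prod_module I M\<^esub> x) i \<noteq> \<zero>\<^bsub>M i\<^esub>} \<subseteq> {i \<in> I. x i \<noteq> \<zero>\<^bsub>M i\<^esub>}"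
      using module.smult_r_null[OF assms(2) a(1)] by (auto simp: prod_module_def)
    with a show "r \<odot>\<^bsub>prod_module I M\<^esub> x \<in> ?H"
      using finite_subset by auto
  qed
qed

lemma sum_module_module:
  assumes "cring R" "\<And>i. i \<in> I \<Longrightarrow> module R (M i)"
  shows "module R (sum_module I M)"
  unfolding sum_module_def
  by (rule submodule.submodule_is_module[OF submodule_sum_module[OF assms] prod_module_module[OF assms]])

locale loc_module = module R M + S?: submonoid S R for R (structure) and M :: "('a, 'm) module" (structure) and S
begin

lemma S_carrier [simp]: "s \<in> S \<Longrightarrow> s \<in> carrier R"
  using S.subset by blast

lemma loc_rel_iff:
  "((m, s), (n, t)) \<in> loc_rel R S M \<longleftrightarrow>
    m \<in> carrier M \<and> s \<in> S \<and> n \<in> carrier M \<and> t \<in> S \<and> (\<exists>u\<in>S. (u \<otimes> t) \<odot>\<^bsub>M\<^esub> m = (u \<otimes> s) \<odot>\<^bsub>M\<^esub> n)"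
  by (auto simp: loc_rel_def smult_assoc1)

lemma loc_rel_equiv: "equiv (carrier M \<times> S) (loc_rel R S M)"
proof (rule equivI)
  show "loc_rel R S M \<subseteq> (carrier M \<times> S) \<times> (carrier M \<times> S)"
    by (auto simp: loc_rel_def)
  show "refl_on (carrier M \<times> S) (loc_rel R S M)"
    using S.one_closed by (auto intro!: refl_onI simp: loc_rel_def)
  show "sym (loc_rel R S M)"
    by (auto intro!: symI simp: loc_rel_def) metis
  show "trans (loc_rel R S M)"
  proof (rule transI, clarify)
    fix m s n t p w
    assume a: "((m, s), (n, t)) \<in> loc_rel R S M" and b: "((n, t), (p, w)) \<in> loc_rel R S M"
    then obtain u v where uv: "u \<in> S" "v \<in> S" "(u \<otimes> t) \<odot>\<^bsub>M\<^esub> m = (u \<otimes> s) \<odot>\<^bsub>M\<^esub> n"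
      "(v \<otimes> w) \<odot>\<^bsub>M\<^esub> n = (v \<otimes> t) \<odot>\<^bsub>M\<^esub> p"
      by (auto simp: loc_rel_iff)
    have c: "m \<in> carrier M" "s \<in> S" "n \<in> carrier M" "t \<in> S" "p \<in> carrier M" "w \<in> S"
      using a b by (auto simp: loc_rel_iff)
    have "((u \<otimes> v \<otimes> t) \<otimes> w) \<odot>\<^bsub>M\<^esub> m = (v \<otimes> w) \<odot>\<^bsub>M\<^esub> ((u \<otimes> t) \<odot>\<^bsub>M\<^esub> m)"
      using uv(1,2) c by (simp add: smult_assoc1[symmetric] m_ac)
    also have "\<dots> = (u \<otimes> s) \<odot>\<^bsub>M\<^esub> ((v \<otimes> w) \<odot>\<^bsub>M\<^esub> n)"
      unfolding uv(3) using uv(1,2) c by (simp add: smult_assoc1[symmetric] m_ac)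
    also have "\<dots> = ((u \<otimes> v \<otimes> t) \<otimes> s) \<odot>\<^bsub>M\<^esub> p"
      unfolding uv(4) using uv(1,2) c by (simp add: smult_assoc1[symmetric] m_ac)
    finally show "((m, s), (p, w)) \<in> loc_rel R S M"
      unfolding loc_rel_iff using uv c by blast
  qed
qed

abbreviation "frac \<equiv> loc_frac R S M"

lemma frac_eq:
  assumes "m \<in> carrier M" "s \<in> S" "n \<in> carrier M" "t \<in> S"
  shows "frac m s = frac n t \<longleftrightarrow> (\<exists>u\<in>S. (u \<otimes> t) \<odot>\<^bsub>M\<^esub> m = (u \<otimes> s) \<odot>\<^bsub>M\<^esub> n)"
  unfolding loc_frac_def using assms by (subst eq_equiv_class_iff[OF loc_rel_equiv]) (auto simp: loc_rel_iff)

lemma frac_eqI: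
  assumes "m \<in> carrier M" "s \<in> S" "n \<in> carrier M" "t \<in> S" "u \<in> S" "(u \<otimes> t) \<odot>\<^bsub>M\<^esub> m = (u \<otimes> s) \<odot>\<^bsub>M\<^esub> n"
  shows "frac m s = frac n t"
  using frac_eq assms by blast

lemma carrier_loc: "carrier (localization R S M) = {frac m s |m s. m \<in> carrier M \<and> s \<in> S}"
  by (auto simp: localization_def quotient_def loc_frac_def)

lemma frac_closed [simp, intro]: "m \<in> carrier M \<Longrightarrow> s \<in> S \<Longrightarrow> frac m s \<in> carrier (localization R S M)"
  by (auto simp: carrier_loc)

lemma smult_frac:
  assumes "r \<in> carrier R" "m \<in> carrier M" "s \<in> S"
  shows "r \<odot>\<^bsub>localization R S M\<^esub> frac m s = frac (r \<odot>\<^bsub>M\<^esub> m) s"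
proof -
  have "(\<lambda>(m, s). frac (r \<odot>\<^bsub>M\<^esub> m) s) respects loc_rel R S M"
  proof (rule congruentI, clarify)
    fix m s n t assume a: "((m, s), (n, t)) \<in> loc_rel R S M"
    then obtain u where u: "u \<in> S" "(u \<otimes> t) \<odot>\<^bsub>M\<^esub> m = (u \<otimes> s) \<odot>\<^bsub>M\<^esub> n"
      and c: "m \<in> carrier M" "s \<in> S" "n \<in> carrier M" "t \<in> S"
      by (auto simp: loc_rel_iff)
    have "(u \<otimes> t) \<odot>\<^bsub>M\<^esub> (r \<odot>\<^bsub>M\<^esub> m) = r \<odot>\<^bsub>M\<^esub> ((u \<otimes> t) \<odot>\<^bsub>M\<^esub> m)"
      using assms(1) u(1) c by (simp add: smult_assoc1[symmetric] m_ac)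
    also have "\<dots> = (u \<otimes> s) \<odot>\<^bsub>M\<^esub> (r \<odot>\<^bsub>M\<^esub> n)"
      unfolding u using assms(1) u(1) c by (simp add: smult_assoc1[symmetric] m_ac)
    finally show "frac (r \<odot>\<^bsub>M\<^esub> m) s = frac (r \<odot>\<^bsub>M\<^esub> n) t"
      using u c assms(1) by (intro frac_eqI) auto
  qed
  from UN_equiv_class[OF loc_rel_equiv this, of "(m, s)"] assms
  show ?thesis
    by (simp add: localization_def loc_frac_def)
qed

lemma add_frac:
  assumes "m \<in> carrier M" "s \<in> S" "n \<in> carrier M" "t \<in> S"
  shows "frac m s \<oplus>\<^bsub>localization R S M\<^esub> frac n t = frac (t \<odot>\<^bsub>M\<^esub> m \<oplus>\<^bsub>M\<^esub> s \<odot>\<^bsub>M\<^esub> n) (s \<otimes> t)"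
proof -
  let ?f = "\<lambda>(m, s) (n, t). frac (t \<odot>\<^bsub>M\<^esub> m \<oplus>\<^bsub>M\<^esub> s \<odot>\<^bsub>M\<^esub> n) (s \<otimes> t)"
  have "congruent2 (loc_rel R S M) (loc_rel R S M) ?f"
  proof (rule congruent2_commuteI[OF loc_rel_equiv])
    fix y z assume "y \<in> carrier M \<times> S" "z \<in> carrier M \<times> S"
    then show "?f y z = ?f z y" by (auto simp: M.a_comm m_comm)
  next
    fix y z w assume w: "w \<in> carrier M \<times> S" and yz: "(y, z) \<in> loc_rel R S M"
    obtain p v where wp: "w = (p, v)" by force
    obtain m s where y: "y = (m, s)" by force
    obtain n t where z: "z = (n, t)" by force
    obtain u where u: "u \<in> S" "(u \<otimes> t) \<odot>\<^bsub>M\<^esub> m = (u \<otimes> s) \<odot>\<^bsub>M\<^esub> n"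
      and c: "m \<in> carrier M" "s \<in> S" "n \<in> carrier M" "t \<in> S"
      using yz y z by (auto simp: loc_rel_iff)
    have wc: "p \<in> carrier M" "v \<in> S" using w wp by auto
    have "(u \<otimes> (v \<otimes> t)) \<odot>\<^bsub>M\<^esub> (s \<odot>\<^bsub>M\<^esub> p \<oplus>\<^bsub>M\<^esub> v \<odot>\<^bsub>M\<^esub> m) =
        (u \<otimes> v \<otimes> t \<otimes> s) \<odot>\<^bsub>M\<^esub> p \<oplus>\<^bsub>M\<^esub> (v \<otimes> v) \<odot>\<^bsub>M\<^esub> ((u \<otimes> t) \<odot>\<^bsub>M\<^esub> m)"
      using u(1) c wc by (simp add: smult_r_distr smult_assoc1[symmetric] m_ac)
    also have "\<dots> = (u \<otimes> (v \<otimes> s)) \<odot>\<^bsub>M\<^esub> (t \<odot>\<^bsub>M\<^esub> p \<oplus>\<^bsub>M\<^esub> v \<odot>\<^bsub>M\<^esub> n)"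
      unfolding u using u(1) c wc by (simp add: smult_r_distr smult_assoc1[symmetric] m_ac)
    finally show "?f w y = ?f w z"
      unfolding wp y z prod.case using u c wc by (intro frac_eqI) auto
  qed
  from UN_equiv_class2[OF loc_rel_equiv loc_rel_equiv this, of "(m, s)" "(n, t)"] assms
  show ?thesis
    by (simp add: localization_def loc_frac_def case_prod_unfold)
qed

lemma zero_loc: "\<zero>\<^bsub>localization R S M\<^esub> = frac \<zero>\<^bsub>M\<^esub> \<one>"
  by (simp add: localization_def)

lemma loc_cases:
  assumes "x \<in> carrier (localization R S M)"
  obtains m s where "m \<in> carrier M" "s \<in> S" "x = frac m s"
  using assms by (auto simp: carrier_loc)

lemma localization_module: "module R (localization R S M)"
proof (rule moduleI)
  show "cring R" by (rule R.is_cring)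
  show "abelian_group (localization R S M)"
  proof (rule abelian_groupI)
    fix x y assume "x \<in> carrier (localization R S M)" "y \<in> carrier (localization R S M)"
    then show "x \<oplus>\<^bsub>localization R S M\<^esub> y \<in> carrier (localization R S M)"
      and "x \<oplus>\<^bsub>localization R S M\<^esub> y = y \<oplus>\<^bsub>localization R S M\<^esub> x"
      by (auto elim!: loc_cases simp: add_frac M.a_comm m_comm)
  next
    show "\<zero>\<^bsub>localization R S M\<^esub> \<in> carrier (localization R S M)" by (simp add: zero_loc)
  next
    fix x y z assume "x \<in> carrier (localization R S M)" "y \<in> carrier (localization R S M)" "z \<in> carrier (localization R S M)"
    then show "x \<oplus>\<^bsub>localization R S M\<^esub> y \<oplus>\<^bsub>localization R S M\<^esub> z = x \<oplus>\<^bsub>localization R S M\<^esub> (y \<oplus>\<^bsub>localization R S M\<^esub> z)"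
      by (auto elim!: loc_cases simp: add_frac smult_r_distr smult_assoc1[symmetric] M.a_assoc m_ac)
  next
    fix x assume x: "x \<in> carrier (localization R S M)"
    then show "\<zero>\<^bsub>localization R S M\<^esub> \<oplus>\<^bsub>localization R S M\<^esub> x = x"
      by (auto elim!: loc_cases simp: zero_loc add_frac)
    from x obtain m s where m: "m \<in> carrier M" "s \<in> S" "x = frac m s" by (rule loc_cases)
    show "\<exists>y\<in>carrier (localization R S M). y \<oplus>\<^bsub>localization R S M\<^esub> x = \<zero>\<^bsub>localization R S M\<^esub>"
    proof (rule bexI[of _ "frac (\<ominus>\<^bsub>M\<^esub> m) s"])
      show "frac (\<ominus>\<^bsub>M\<^esub> m) s \<oplus>\<^bsub>localization R S M\<^esub> x = \<zero>\<^bsub>localization R S M\<^esub>"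
        using m frac_eqI[of "\<zero>\<^bsub>M\<^esub>" "s \<otimes> s" "\<zero>\<^bsub>M\<^esub>" \<one> \<one>]
        by (simp add: zero_loc add_frac smult_r_minus M.l_neg)
    qed (use m in auto)
  qed
next
  fix a b x assume ab: "a \<in> carrier R" "b \<in> carrier R" and x: "x \<in> carrier (localization R S M)"
  from x obtain m s where m: "m \<in> carrier M" "s \<in> S" "x = frac m s" by (rule loc_cases)
  have "frac ((a \<oplus> b) \<odot>\<^bsub>M\<^esub> m) s = frac (s \<odot>\<^bsub>M\<^esub> (a \<odot>\<^bsub>M\<^esub> m) \<oplus>\<^bsub>M\<^esub> s \<odot>\<^bsub>M\<^esub> (b \<odot>\<^bsub>M\<^esub> m)) (s \<otimes> s)"
    by (rule frac_eqI[of _ _ _ _ \<one>])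
      (use ab m in \<open>simp_all add: smult_l_distr smult_r_distr smult_assoc1[symmetric] m_ac\<close>)
  then show "(a \<oplus> b) \<odot>\<^bsub>localization R S M\<^esub> x = a \<odot>\<^bsub>localization R S M\<^esub> x \<oplus>\<^bsub>localization R S M\<^esub> b \<odot>\<^bsub>localization R S M\<^esub> x"
    using ab m by (simp add: smult_frac add_frac)
next
  fix a x y assume a: "a \<in> carrier R" and xy: "x \<in> carrier (localization R S M)" "y \<in> carrier (localization R S M)"
  then show "a \<odot>\<^bsub>localization R S M\<^esub> (x \<oplus>\<^bsub>localization R S M\<^esub> y) = a \<odot>\<^bsub>localization R S M\<^esub> x \<oplus>\<^bsub>localization R S M\<^esub> a \<odot>\<^bsub>localization R S M\<^esub> y"
    by (auto elim!: loc_cases simp: smult_frac add_frac smult_r_distr smult_assoc1[symmetric] m_ac)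
qed (auto elim!: loc_cases simp: smult_frac add_frac smult_r_distr smult_assoc1[symmetric] m_ac)

end

lemma mod_homI:
  assumes "\<And>x. x \<in> carrier M \<Longrightarrow> h x \<in> carrier N"
    "\<And>x y. x \<in> carrier M \<Longrightarrow> y \<in> carrier M \<Longrightarrow> h (x \<oplus>\<^bsub>M\<^esub> y) = h x \<oplus>\<^bsub>N\<^esub> h y"
    "\<And>r x. r \<in> carrier R \<Longrightarrow> x \<in> carrier M \<Longrightarrow> h (r \<odot>\<^bsub>M\<^esub> x) = r \<odot>\<^bsub>N\<^esub> h x"
  shows "h \<in> mod_hom R M N"
  using assms by (auto simp: mod_hom_def)

lemma mod_homD:
  assumes "h \<in> mod_hom R M N"
  shows "x \<in> carrier M \<Longrightarrow> h x \<in> carrier N"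
    "x \<in> carrier M \<Longrightarrow> y \<in> carrier M \<Longrightarrow> h (x \<oplus>\<^bsub>M\<^esub> y) = h x \<oplus>\<^bsub>N\<^esub> h y"
    "r \<in> carrier R \<Longrightarrow> x \<in> carrier M \<Longrightarrow> h (r \<odot>\<^bsub>M\<^esub> x) = r \<odot>\<^bsub>N\<^esub> h x"
  using assms by (auto simp: mod_hom_def)

lemma mod_hom_comp:
  assumes "f \<in> mod_hom R A B" "g \<in> mod_hom R B C"
  shows "(\<lambda>x. g (f x)) \<in> mod_hom R A C"
  by (rule mod_homI) (simp_all add: mod_homD[OF assms(1)] mod_homD[OF assms(2)])

lemma mod_hom_zero:
  assumes "module R M" "module R N" "h \<in> mod_hom R M N"
  shows "h \<zero>\<^bsub>M\<^esub> = \<zero>\<^bsub>N\<^esub>"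
proof -
  interpret M: module R M by fact
  interpret N: module R N by fact
  have "h (\<zero>\<^bsub>R\<^esub> \<odot>\<^bsub>M\<^esub> \<zero>\<^bsub>M\<^esub>) = \<zero>\<^bsub>R\<^esub> \<odot>\<^bsub>N\<^esub> h \<zero>\<^bsub>M\<^esub>"
    by (simp only: mod_homD[OF assms(3)] M.R.zero_closed M.M.zero_closed)
  then show ?thesis using mod_homD(1)[OF assms(3)] by simp
qed

lemma mod_hom_minus:
  assumes "module R M" "module R N" "h \<in> mod_hom R M N" "x \<in> carrier M"
  shows "h (\<ominus>\<^bsub>M\<^esub> x) = \<ominus>\<^bsub>N\<^esub> h x"
proof -
  interpret M: module R M by fact
  interpret N: module R N by fact
  have "h (\<ominus>\<^bsub>M\<^esub> x) \<oplus>\<^bsub>N\<^esub> h x = \<zero>\<^bsub>N\<^esub>"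
    using mod_homD(2)[OF assms(3), of "\<ominus>\<^bsub>M\<^esub> x" x] mod_hom_zero[OF assms(1-3)] assms(4) by (simp add: M.M.l_neg)
  then show ?thesis
    using N.M.minus_equality mod_homD(1)[OF assms(3)] assms(4) by (metis M.M.a_inv_closed)
qed

lemma Hom_module_module:
  assumes "module R M" "module R N"
  shows "module R (Hom_module R M N)"
proof -
  interpret M: module R M by fact
  interpret N: module R N by fact
  show ?thesis
  proof (rule moduleI)
    show "cring R" by (rule M.R.is_cring)
    show "abelian_group (Hom_module R M N)"
    proof (rule abelian_groupI, goal_cases)
      case (1 x y)
      then show ?case
        by (auto simp: Hom_module_def mod_homD N.smult_r_distr intro!: mod_homI) (simp add: mod_homD N.M.a_ac)
    next
      case 2
      then show ?case by (auto simp: Hom_module_def intro!: mod_homI)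
    next
      case (3 x y z)
      then show ?case by (auto simp: Hom_module_def mod_homD N.M.a_assoc intro!: restrict_ext)
    next
      case (4 x y)
      then show ?case by (auto simp: Hom_module_def mod_homD N.M.a_comm intro!: restrict_ext)
    next
      case (5 x)
      then show ?case by (auto simp: Hom_module_def mod_homD extensional_def)
    next
      case (6 h)
      then have h: "h \<in> mod_hom R M N" by (simp add: Hom_module_def)
      show ?case
        apply (rule bexI[of _ "\<lambda>x\<in>carrier M. \<ominus>\<^bsub>N\<^esub> h x"])
        using h by (auto simp: Hom_module_def mod_homD N.M.l_neg N.M.r_neg N.M.minus_add N.smult_r_minus N.M.a_comm intro!: mod_homI restrict_ext)
    qed
  next
    fix r h assume "r \<in> carrier R" "h \<in> carrier (Hom_module R M N)"
    then show "r \<odot>\<^bsub>Hom_module R M N\<^esub> h \<in> carrier (Hom_module R M N)"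
      by (auto simp: Hom_module_def mod_homD N.smult_r_distr N.smult_assoc1[symmetric] M.R.m_comm intro!: mod_homI)
  qed (auto simp: Hom_module_def mod_homD N.smult_l_distr N.smult_r_distr N.smult_assoc1 extensional_def intro!: restrict_ext)
qed

lemma compose_hom:
  assumes "module R L" "module R A" "f \<in> mod_hom R A B"
  shows "compose (carrier L) f \<in> mod_hom R (Hom_module R L A) (Hom_module R L B)"
proof (rule mod_homI)
  interpret L: module R L by fact
  fix x assume "x \<in> carrier (Hom_module R L A)"
  then show "compose (carrier L) f x \<in> carrier (Hom_module R L B)"
    using assms(3) by (auto simp: Hom_module_def compose_def mod_homD intro!: mod_homI)
qed (use assms(3) in \<open>auto simp: Hom_module_def compose_def mod_homD intro!: restrict_ext\<close>)

lemma short_exact_Hom_iff: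
  assumes se: "short_exact R A f B g C" and L: "module R L"
  shows "short_exact R (Hom_module R L A) (compose (carrier L) f) (Hom_module R L B)
           (compose (carrier L) g) (Hom_module R L C)
     \<longleftrightarrow> (\<forall>h \<in> mod_hom R L C. \<exists>k \<in> mod_hom R L B. \<forall>x\<in>carrier L. g (k x) = h x)" (is "?L \<longleftrightarrow> ?R")
proof -
  have A: "module R A" and B: "module R B" and C: "module R C" and f: "f \<in> mod_hom R A B"
    and g: "g \<in> mod_hom R B C" and inj: "inj_on f (carrier A)" and ex: "f ` carrier A = a_kernel B C g"
    and surj: "g ` carrier B = carrier C"
    using se by (auto simp: short_exact_def)
  interpret L: module R L by fact
  interpret A: module R A by fact
  have ex': "f a \<in> carrier B" "g (f a) = \<zero>\<^bsub>C\<^esub>" if "a \<in> carrier A" for a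
    using ex that by (auto simp: a_kernel_def' kernel_def)
  have injH: "inj_on (compose (carrier L) f) (carrier (Hom_module R L A))"
  proof (rule inj_onI)
    fix x y assume x: "x \<in> carrier (Hom_module R L A)" and y: "y \<in> carrier (Hom_module R L A)"
      and eq: "compose (carrier L) f x = compose (carrier L) f y"
    show "x = y"
    proof (rule extensionalityI)
      show "x \<in> extensional (carrier L)" "y \<in> extensional (carrier L)" using x y by (auto simp: Hom_module_def)
      fix l assume l: "l \<in> carrier L"
      have "f (x l) = f (y l)" using fun_cong[OF eq, of l] l by (simp add: compose_def)
      then show "x l = y l" using inj x y l by (auto simp: Hom_module_def mod_homD dest!: inj_onD)
    qed
  qed
  have exH: "compose (carrier L) f ` carrier (Hom_module R L A) =
      a_kernel (Hom_module R L B) (Hom_module R L C) (compose (carrier L) g)" (is "?I = ?K")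
  proof (intro equalityI subsetI)
    fix y assume "y \<in> ?I"
    then obtain x where x: "x \<in> carrier (Hom_module R L A)" "y = compose (carrier L) f x" by auto
    have "y \<in> carrier (Hom_module R L B)"
      unfolding x(2) by (rule mod_homD(1)[OF compose_hom[OF L A f] x(1)])
    moreover have "compose (carrier L) g y = \<zero>\<^bsub>Hom_module R L C\<^esub>"
      using x by (auto simp: compose_def Hom_module_def mod_homD ex' intro!: restrict_ext)
    ultimately show "y \<in> ?K" by (simp add: a_kernel_def' kernel_def)
  next
    fix y assume "y \<in> ?K"
    then have y: "y \<in> mod_hom R L B" "y \<in> extensional (carrier L)"
      and gy: "compose (carrier L) g y = \<zero>\<^bsub>Hom_module R L C\<^esub>"
      by (auto simp: a_kernel_def' kernel_def Hom_module_def)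
    have im: "y l \<in> f ` carrier A" if l: "l \<in> carrier L" for l
      using fun_cong[OF gy, of l] l mod_homD(1)[OF y(1) l] unfolding ex
      by (simp add: a_kernel_def' kernel_def compose_def Hom_module_def)
    define x where "x = (\<lambda>l\<in>carrier L. inv_into (carrier A) f (y l))"
    have xA: "x l \<in> carrier A" and fx: "f (x l) = y l" if "l \<in> carrier L" for l
      using im[OF that] that by (auto simp: x_def inv_into_into f_inv_into_f)
    have "x \<in> mod_hom R L A"
    proof (rule mod_homI)
      fix l m assume l: "l \<in> carrier L" "m \<in> carrier L"
      show "x (l \<oplus>\<^bsub>L\<^esub> m) = x l \<oplus>\<^bsub>A\<^esub> x m"
        by (rule inj_onD[OF inj]) (use l xA in \<open>simp_all add: fx mod_homD[OF f] mod_homD[OF y(1)]\<close>)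
    next
      fix r l assume l: "r \<in> carrier R" "l \<in> carrier L"
      show "x (r \<odot>\<^bsub>L\<^esub> l) = r \<odot>\<^bsub>A\<^esub> x l"
        by (rule inj_onD[OF inj]) (use l xA in \<open>simp_all add: fx mod_homD[OF f] mod_homD[OF y(1)]\<close>)
    qed (rule xA)
    then have "x \<in> carrier (Hom_module R L A)" by (simp add: Hom_module_def x_def)
    moreover have "y = compose (carrier L) f x"
      by (rule extensionalityI[OF y(2)]) (simp_all add: compose_def fx)
    ultimately show "y \<in> ?I" by blast
  qed
  have "?L \<longleftrightarrow> compose (carrier L) g ` carrier (Hom_module R L B) = carrier (Hom_module R L C)"
    unfolding short_exact_def using injH exH Hom_module_module[OF L A] Hom_module_module[OF L B]
      Hom_module_module[OF L C] compose_hom[OF L A f] compose_hom[OF L B g] by simp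
  also have "\<dots> \<longleftrightarrow> ?R"
  proof
    assume S: "compose (carrier L) g ` carrier (Hom_module R L B) = carrier (Hom_module R L C)"
    show ?R
    proof
      fix h assume h: "h \<in> mod_hom R L C"
      then have "restrict h (carrier L) \<in> carrier (Hom_module R L C)"
        by (auto simp: Hom_module_def mod_homD intro!: mod_homI)
      then obtain k where k: "k \<in> carrier (Hom_module R L B)" "restrict h (carrier L) = compose (carrier L) g k"
        unfolding S[symmetric] by auto
      have "g (k x) = h x" if "x \<in> carrier L" for x
        using fun_cong[OF k(2), of x] that by (simp add: compose_def)
      with k(1) show "\<exists>k \<in> mod_hom R L B. \<forall>x\<in>carrier L. g (k x) = h x"
        by (auto simp: Hom_module_def)
    qed
  next
    assume H: ?R
    show "compose (carrier L) g ` carrier (Hom_module R L B) = carrier (Hom_module R L C)"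
    proof (intro equalityI subsetI)
      fix y assume "y \<in> compose (carrier L) g ` carrier (Hom_module R L B)"
      then show "y \<in> carrier (Hom_module R L C)" using mod_homD(1)[OF compose_hom[OF L B g]] by blast
    next
      fix h assume h: "h \<in> carrier (Hom_module R L C)"
      then obtain k where k: "k \<in> mod_hom R L B" "\<And>x. x \<in> carrier L \<Longrightarrow> g (k x) = h x"
        using H by (auto simp: Hom_module_def)
      have "restrict k (carrier L) \<in> carrier (Hom_module R L B)"
        using k by (auto simp: Hom_module_def mod_homD intro!: mod_homI)
      moreover have "h = compose (carrier L) g (restrict k (carrier L))"
        using h k by (auto simp: Hom_module_def compose_def extensional_def)
      ultimately show "h \<in> compose (carrier L) g ` carrier (Hom_module R L B)" by blast
    qed
  qed
  finally show ?thesis .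
qed

locale mono_module = M: module R M + N: module R N
  for R :: "('r, 'x) ring_scheme" and M :: "('r, 'm) module" and N :: "('r, 'n) module" +
  fixes f
  assumes f: "f \<in> mod_hom R M N" and inj: "inj_on f (carrier M)"
begin

definition "K = f ` carrier M"

lemma K_sub: "submodule K R N"
proof (rule N.submoduleI)
  note fz = mod_hom_zero[OF M.module_axioms N.module_axioms f]
  show "\<zero>\<^bsub>N\<^esub> \<in> K" unfolding K_def fz[symmetric] by blast
  fix a assume "a \<in> K"
  then show "\<ominus>\<^bsub>N\<^esub> a \<in> K"
    by (auto simp: K_def mod_hom_minus[OF M.module_axioms N.module_axioms f, symmetric])
next
  fix a b assume "a \<in> K" "b \<in> K"
  then obtain m n where m: "m \<in> carrier M" "n \<in> carrier M" "a = f m" "b = f n" by (auto simp: K_def)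
  show "a \<oplus>\<^bsub>N\<^esub> b \<in> K"
    unfolding K_def by (rule image_eqI[of _ _ "m \<oplus>\<^bsub>M\<^esub> n"]) (use m in \<open>auto simp: mod_homD[OF f]\<close>)
next
  fix r a assume r: "r \<in> carrier R" "a \<in> K"
  then obtain m where m: "m \<in> carrier M" "a = f m" by (auto simp: K_def)
  show "r \<odot>\<^bsub>N\<^esub> a \<in> K"
    unfolding K_def by (rule image_eqI[of _ _ "r \<odot>\<^bsub>M\<^esub> m"]) (use r m in \<open>auto simp: mod_homD[OF f]\<close>)
qed (auto simp: K_def mod_homD[OF f])

sublocale K: abelian_subgroup K N
  using K_sub N.abelian_group_axioms
  by (intro abelian_subgroupI3 additive_subgroupI) (auto simp: submodule_def)

abbreviation "p \<equiv> coker_proj M f N"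
abbreviation "C \<equiv> coker M f N"

lemma p_def: "p x = K +>\<^bsub>N\<^esub> x" by (simp add: coker_proj_def K_def)

lemma p_eq:
  assumes "x \<in> carrier N" "y \<in> carrier N"
  shows "p x = p y \<longleftrightarrow> (\<exists>m\<in>carrier M. x = f m \<oplus>\<^bsub>N\<^esub> y)"
proof -
  have "p x = p y \<longleftrightarrow> x \<in> K +>\<^bsub>N\<^esub> y"
  proof
    assume "p x = p y"
    then show "x \<in> K +>\<^bsub>N\<^esub> y" using K.a_rcos_self[OF assms(1)] by (simp add: p_def)
  next
    assume "x \<in> K +>\<^bsub>N\<^esub> y"
    then show "p x = p y" unfolding p_def using N.a_repr_independence[OF _ assms(2) K.a_subgroup] by simp
  qed
  then show ?thesis by (auto simp: a_r_coset_def' K_def)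
qed

lemma C_carrier: "carrier C = p ` carrier N"
  by (auto simp: coker_def quot_module_def A_RCOSETS_def' coker_proj_def)

lemma C_add: "x \<in> carrier N \<Longrightarrow> y \<in> carrier N \<Longrightarrow> p x \<oplus>\<^bsub>C\<^esub> p y = p (x \<oplus>\<^bsub>N\<^esub> y)"
  by (simp add: coker_def quot_module_def p_def K_def[symmetric] K.a_rcos_sum)

lemma C_zero: "\<zero>\<^bsub>C\<^esub> = p \<zero>\<^bsub>N\<^esub>"
  by (simp add: coker_def quot_module_def p_def K_def[symmetric] K.a_subset)

lemma C_smult:
  assumes "r \<in> carrier R" "x \<in> carrier N" shows "r \<odot>\<^bsub>C\<^esub> p x = p (r \<odot>\<^bsub>N\<^esub> x)"
proof -
  have "p (r \<odot>\<^bsub>N\<^esub> y) = p (r \<odot>\<^bsub>N\<^esub> x)" if y: "y \<in> p x" for y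
  proof -
    obtain m where m: "m \<in> carrier M" "y = f m \<oplus>\<^bsub>N\<^esub> x" using y by (auto simp: p_def a_r_coset_def' K_def)
    have "r \<odot>\<^bsub>N\<^esub> y = f (r \<odot>\<^bsub>M\<^esub> m) \<oplus>\<^bsub>N\<^esub> r \<odot>\<^bsub>N\<^esub> x"
      using m assms by (simp add: mod_homD[OF f] N.smult_r_distr)
    moreover have "r \<odot>\<^bsub>N\<^esub> y \<in> carrier N" "r \<odot>\<^bsub>N\<^esub> x \<in> carrier N" "r \<odot>\<^bsub>M\<^esub> m \<in> carrier M"
      using m assms by (simp_all add: mod_homD[OF f])
    ultimately show ?thesis using p_eq by blast
  qed
  moreover have "x \<in> p x" using assms by (simp add: p_def K.a_rcos_self)
  ultimately have "(\<Union>y\<in>p x. p (r \<odot>\<^bsub>N\<^esub> y)) = p (r \<odot>\<^bsub>N\<^esub> x)" by blast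
  then show ?thesis by (simp add: coker_def quot_module_def p_def K_def[symmetric])
qed

lemma C_module: "module R C"
proof (rule moduleI)
  show "cring R" by (rule M.R.is_cring)
  show "abelian_group C"
  proof (rule abelian_groupI)
    fix x assume "x \<in> carrier C"
    then obtain y where y: "y \<in> carrier N" "x = p y" by (auto simp: C_carrier)
    show "\<exists>y\<in>carrier C. y \<oplus>\<^bsub>C\<^esub> x = \<zero>\<^bsub>C\<^esub>"
      by (rule bexI[of _ "p (\<ominus>\<^bsub>N\<^esub> y)"]) (use y in \<open>auto simp: C_carrier C_add C_zero N.M.l_neg\<close>)
  qed (auto simp: C_carrier C_add C_zero N.M.a_ac)
qed (auto simp: C_carrier C_add C_smult N.smult_l_distr N.smult_r_distr N.smult_assoc1)

lemma p_hom: "p \<in> mod_hom R N C"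
  by (rule mod_homI) (auto simp: C_carrier C_add C_smult)

lemma coker_exact: "short_exact R M f N p C"
proof -
  have "f ` carrier M = a_kernel N C p"
  proof -
    have "p x = \<zero>\<^bsub>C\<^esub> \<longleftrightarrow> x \<in> f ` carrier M" if "x \<in> carrier N" for x
      unfolding C_zero using that by (subst p_eq) (auto simp: mod_homD[OF f])
    moreover have "f ` carrier M \<subseteq> carrier N" by (auto simp: mod_homD[OF f])
    ultimately show ?thesis unfolding a_kernel_def' by blast
  qed
  then show ?thesis
    unfolding short_exact_def using M.module_axioms N.module_axioms C_module f p_hom inj C_carrier by auto
qed

end

definition transport :: "('a \<Rightarrow> 'b) \<Rightarrow> ('r, 'a) module \<Rightarrow> ('r, 'b) module" where
  "transport e N = \<lparr>carrier = e ` carrier N, mult = undefined, one = undefined, zero = e \<zero>\<^bsub>N\<^esub>,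
    add = (\<lambda>x y. e (inv_into (carrier N) e x \<oplus>\<^bsub>N\<^esub> inv_into (carrier N) e y)),
    smult = (\<lambda>r x. e (r \<odot>\<^bsub>N\<^esub> inv_into (carrier N) e x))\<rparr>"

locale transport_module = N: module R N
  for R :: "('r, 'x) ring_scheme" and N :: "('r, 'n) module" +
  fixes e :: "'n \<Rightarrow> 'b"
  assumes inj: "inj_on e (carrier N)"
begin

abbreviation "d \<equiv> inv_into (carrier N) e"
abbreviation "T \<equiv> transport e N"

lemma d_e [simp]: "x \<in> carrier N \<Longrightarrow> d (e x) = x" using inj by simp

lemma T_module: "module R T"
proof (rule moduleI)
  show "cring R" by (rule N.R.is_cring)
  show "abelian_group T"
  proof (rule abelian_groupI)
    fix x assume "x \<in> carrier T"
    then obtain y where y: "y \<in> carrier N" "x = e y" by (auto simp: transport_def)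
    show "\<exists>y\<in>carrier T. y \<oplus>\<^bsub>T\<^esub> x = \<zero>\<^bsub>T\<^esub>"
      by (rule bexI[of _ "e (\<ominus>\<^bsub>N\<^esub> y)"]) (use y in \<open>auto simp: transport_def N.M.l_neg\<close>)
  qed (auto simp: transport_def N.M.a_ac)
qed (auto simp: transport_def N.smult_l_distr N.smult_r_distr N.smult_assoc1)

lemma e_hom: "e \<in> mod_hom R N T"
  by (rule mod_homI) (auto simp: transport_def)

lemma d_hom: "d \<in> mod_hom R T N"
  by (rule mod_homI) (auto simp: transport_def)

end

lemma loc_map:
  assumes M: "module R M" and N: "module R N" and S: "submonoid S R" and u: "u \<in> mod_hom R M N"
  obtains v where "v \<in> mod_hom R (localization R S M) (localization R S N)"
    and "\<And>m s. m \<in> carrier M \<Longrightarrow> s \<in> S \<Longrightarrow> v (loc_frac R S M m s) = loc_frac R S N (u m) s"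
proof -
  interpret M: loc_module R M S using M S by (simp add: loc_module_def)
  interpret N: loc_module R N S using N S by (simp add: loc_module_def)
  define v where "v = (\<lambda>X. \<Union>(m, s)\<in>X. loc_frac R S N (u m) s)"
  have v: "v (loc_frac R S M m s) = loc_frac R S N (u m) s" if ms: "m \<in> carrier M" "s \<in> S" for m s
  proof -
    have "(\<lambda>(m, s). loc_frac R S N (u m) s) respects loc_rel R S M"
    proof (rule congruentI, clarify)
      fix m s n t assume "((m, s), (n, t)) \<in> loc_rel R S M"
      then obtain w where w: "w \<in> S" "(w \<otimes>\<^bsub>R\<^esub> t) \<odot>\<^bsub>M\<^esub> m = (w \<otimes>\<^bsub>R\<^esub> s) \<odot>\<^bsub>M\<^esub> n"
        and c: "m \<in> carrier M" "s \<in> S" "n \<in> carrier M" "t \<in> S"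
        by (auto simp: M.loc_rel_iff)
      from arg_cong[OF w(2), of u] show "loc_frac R S N (u m) s = loc_frac R S N (u n) t"
        using w(1) c by (intro N.frac_eqI[of _ _ _ _ w]) (auto simp: mod_homD[OF u])
    qed
    from UN_equiv_class[OF M.loc_rel_equiv this, of "(m, s)"] ms
    show ?thesis by (simp add: v_def loc_frac_def)
  qed
  have "v \<in> mod_hom R (localization R S M) (localization R S N)"
    by (rule mod_homI)
      (auto elim!: M.loc_cases simp: v M.add_frac N.add_frac M.smult_frac N.smult_frac mod_homD[OF u])
  with v that show thesis by blast
qed

lemma S_pure_exact_any_type:
  fixes P :: "('r, 'p) module"
  assumes S: "submonoid S R" and pure: "S_pure_exact R S A f B g C" and fp: "finitely_presented R P"
  shows "short_exact R
         (Hom_module R (localization R S P) A) (compose (carrier (localization R S P)) f)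
         (Hom_module R (localization R S P) B) (compose (carrier (localization R S P)) g)
         (Hom_module R (localization R S P) C)"
proof -
  have P: "module R P" using fp by (simp add: finitely_presented_def)
  have se: "short_exact R A f B g C" using pure by (simp add: S_pure_exact_def)
  from fp obtain m n \<phi> \<psi> where \<phi>: "\<phi> \<in> mod_hom R (free_module R m) (free_module R n)"
    and \<psi>: "\<psi> \<in> mod_hom R (free_module R n) P"
    and ker: "\<phi> ` carrier (free_module R m) = a_kernel (free_module R n) P \<psi>"
    and surj: "\<psi> ` carrier (free_module R n) = carrier P"
    by (auto simp: finitely_presented_def)
  define e where "e = (\<lambda>p. {x \<in> carrier (free_module R n). \<psi> x = p})"
  interpret transport_module R P e
  proof (intro transport_module.intro P transport_module_axioms.intro inj_onI)
    fix x y assume xy: "x \<in> carrier P" "y \<in> carrier P" "e x = e y"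
    then obtain a where "a \<in> carrier (free_module R n)" "\<psi> a = x" unfolding surj[symmetric] by auto
    then have "a \<in> e x" by (simp add: e_def)
    with xy \<open>\<psi> a = x\<close> show "x = y" by (simp add: e_def)
  qed
  have "finitely_presented R T"
    unfolding finitely_presented_def
  proof (intro conjI exI)
    show "module R T" by (rule T_module)
    show "\<phi> \<in> mod_hom R (free_module R m) (free_module R n)" by (rule \<phi>)
    show "(\<lambda>x. e (\<psi> x)) \<in> mod_hom R (free_module R n) T" by (rule mod_hom_comp[OF \<psi> e_hom])
    have "e (\<psi> x) = \<zero>\<^bsub>T\<^esub> \<longleftrightarrow> \<psi> x = \<zero>\<^bsub>P\<^esub>" if "x \<in> carrier (free_module R n)" for x
      using inj_on_eq_iff[OF inj, of "\<psi> x" "\<zero>\<^bsub>P\<^esub>"] mod_homD(1)[OF \<psi> that] by (simp add: transport_def)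
    then show "\<phi> ` carrier (free_module R m) = a_kernel (free_module R n) T (\<lambda>x. e (\<psi> x))"
      unfolding ker by (auto simp: a_kernel_def' kernel_def)
    show "(\<lambda>x. e (\<psi> x)) ` carrier (free_module R n) = carrier T"
      unfolding transport_def using surj by (auto simp: image_image[symmetric])
  qed
  then have T: "short_exact R (Hom_module R (localization R S T) A) (compose (carrier (localization R S T)) f)
         (Hom_module R (localization R S T) B) (compose (carrier (localization R S T)) g)
         (Hom_module R (localization R S T) C)"
    using pure by (simp add: S_pure_exact_def)
  interpret LP: loc_module R P S using P S by (simp add: loc_module_def)
  interpret LT: loc_module R T S using T_module S by (simp add: loc_module_def)
  obtain i where i: "i \<in> mod_hom R (localization R S P) (localization R S T)"
    and i': "\<And>m s. m \<in> carrier P \<Longrightarrow> s \<in> S \<Longrightarrow> i (loc_frac R S P m s) = loc_frac R S T (e m) s"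
    using loc_map[OF P T_module S e_hom] by blast
  obtain j where j: "j \<in> mod_hom R (localization R S T) (localization R S P)"
    and j': "\<And>m s. m \<in> carrier T \<Longrightarrow> s \<in> S \<Longrightarrow> j (loc_frac R S T m s) = loc_frac R S P (d m) s"
    using loc_map[OF T_module P S d_hom] by blast
  have ji: "j (i x) = x" if "x \<in> carrier (localization R S P)" for x
    using that by (auto elim!: LP.loc_cases simp: i' j' mod_homD[OF e_hom])
  show ?thesis
    unfolding short_exact_Hom_iff[OF se LP.localization_module]
  proof
    fix h assume h: "h \<in> mod_hom R (localization R S P) C"
    obtain k where k: "k \<in> mod_hom R (localization R S T) B"
      "\<And>x. x \<in> carrier (localization R S T) \<Longrightarrow> g (k x) = h (j x)"
      using bspec[OF T[unfolded short_exact_Hom_iff[OF se LT.localization_module]] mod_hom_comp[OF j h]] by auto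
    show "\<exists>k\<in>mod_hom R (localization R S P) B. \<forall>x\<in>carrier (localization R S P). g (k x) = h x"
      by (rule bexI[OF _ mod_hom_comp[OF i k(1)]]) (simp add: k(2) mod_homD[OF i] ji)
  qed
qed

lemma S_FP_injective_any_type:
  fixes N :: "('r, 'n) module" and M :: "('r, 'm) module"
  assumes S: "submonoid S R" and fpi: "S_FP_injective R S M"
    and N: "module R N" and f: "f \<in> mod_hom R M N" and inj: "inj_on f (carrier M)"
  shows "S_pure_mono R S M f N"
proof -
  have M: "module R M" using fpi by (simp add: S_FP_injective_def)
  interpret mono_module R M N f
    using M N f inj by (simp add: mono_module_def mono_module_axioms_def)
  show ?thesis
    unfolding S_pure_mono_def S_pure_exact_def
  proof (intro conjI allI impI coker_exact)
    fix P :: "('r, (nat \<Rightarrow> 'r) set) module" assume fp: "finitely_presented R P"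
    then have P: "module R P" by (simp add: finitely_presented_def)
    from fp obtain n \<psi> where \<psi>: "\<psi> \<in> mod_hom R (free_module R n) P"
      and surj: "\<psi> ` carrier (free_module R n) = carrier P"
      by (auto simp: finitely_presented_def)
    interpret L: loc_module R P S using P S by (simp add: loc_module_def)
    let ?L = "localization R S P"
    interpret L': module R ?L by (rule L.localization_module)
    show "short_exact R (Hom_module R ?L M) (compose (carrier ?L) f) (Hom_module R ?L N)
        (compose (carrier ?L) p) (Hom_module R ?L C)"
      unfolding short_exact_Hom_iff[OF coker_exact L.localization_module]
    proof
      fix h assume h: "h \<in> mod_hom R ?L C"
      note hz = mod_hom_zero[OF L.localization_module C_module h]
      define N' where "N' = {y \<in> carrier N. p y \<in> h ` carrier ?L}"
      have N'I: "y \<in> N'" if "y \<in> carrier N" "x \<in> carrier ?L" "p y = h x" for x y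
        using that by (auto simp: N'_def)
      have N'E: "\<exists>x\<in>carrier ?L. p y = h x" "y \<in> carrier N" if "y \<in> N'" for y
        using that by (auto simp: N'_def)
      have fN': "f m \<in> N'" if "m \<in> carrier M" for m
        using that hz L'.M.zero_closed
        by (intro N'I[of _ "\<zero>\<^bsub>?L\<^esub>"]) (auto simp: mod_homD[OF f] C_zero p_eq)
      have sub: "submodule N' R N"
      proof (rule N.submoduleI)
        show "N' \<subseteq> carrier N" by (auto simp: N'_def)
        show "\<zero>\<^bsub>N\<^esub> \<in> N'" by (rule N'I[of _ "\<zero>\<^bsub>?L\<^esub>"]) (use hz in \<open>auto simp: C_zero\<close>)
      next
        fix a assume "a \<in> N'"
        then obtain x where x: "a \<in> carrier N" "x \<in> carrier ?L" "p a = h x" using N'E by blast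
        show "\<ominus>\<^bsub>N\<^esub> a \<in> N'"
          by (rule N'I[of _ "\<ominus>\<^bsub>?L\<^esub> x"])
            (use x in \<open>auto simp: mod_hom_minus[OF N C_module p_hom] mod_hom_minus[OF L.localization_module C_module h]\<close>)
      next
        fix a b assume "a \<in> N'" "b \<in> N'"
        then obtain x y where x: "a \<in> carrier N" "x \<in> carrier ?L" "p a = h x"
          "b \<in> carrier N" "y \<in> carrier ?L" "p b = h y" using N'E by metis
        show "a \<oplus>\<^bsub>N\<^esub> b \<in> N'"
          by (rule N'I[of _ "x \<oplus>\<^bsub>?L\<^esub> y"]) (use x in \<open>auto simp: mod_homD[OF h] mod_homD[OF p_hom]\<close>)
      next
        fix r a assume r: "r \<in> carrier R" "a \<in> N'"
        then obtain x where x: "a \<in> carrier N" "x \<in> carrier ?L" "p a = h x" using N'E by blast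
        show "r \<odot>\<^bsub>N\<^esub> a \<in> N'"
          by (rule N'I[of _ "r \<odot>\<^bsub>?L\<^esub> x"]) (use x r in \<open>auto simp: mod_homD[OF h] mod_homD[OF p_hom]\<close>)
      qed
      define N1 where "N1 = N\<lparr>carrier := N'\<rparr>"
      have N1 [simp]: "carrier N1 = N'" "\<zero>\<^bsub>N1\<^esub> = \<zero>\<^bsub>N\<^esub>" "add N1 = add N" "smult N1 = smult N"
        by (simp_all add: N1_def)
      have modN1: "module R N1"
        unfolding N1_def by (rule submodule.submodule_is_module[OF sub N])
      define D where "D = (\<lambda>l. h (loc_frac R S P (\<psi> (\<lambda>i\<in>{..<n}. tl l ! i)) (hd l)))"
      have code: "\<exists>l. D l = p y" if y: "y \<in> N'" for y
      proof -
        obtain x where x: "x \<in> carrier ?L" "p y = h x" using N'E[OF y] by blast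
        obtain q s where q: "q \<in> carrier P" "s \<in> S" "x = loc_frac R S P q s" using x(1) by (rule L.loc_cases)
        obtain a where a: "a \<in> carrier (free_module R n)" "q = \<psi> a" using q(1) surj by blast
        have "(\<lambda>i\<in>{..<n}. map a [0..<n] ! i) = a"
          using a(1) by (auto simp: free_module_def prod_module_def PiE_iff extensional_def)
        then have "D (s # map a [0..<n]) = p y" by (simp add: D_def x q a)
        then show ?thesis by blast
      qed
      define c where "c = (\<lambda>X. SOME l. D l = X)"
      define r where "r = (\<lambda>X. SOME y. y \<in> N' \<and> p y = X)"
      define b where "b = (\<lambda>y. SOME m. m \<in> carrier M \<and> y = f m \<oplus>\<^bsub>N\<^esub> r (p y))"
      define e where "e = (\<lambda>y. (b y, c (p y)))"
      have c: "D (c (p y)) = p y" if "y \<in> N'" for y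
        unfolding c_def by (rule someI_ex[OF code[OF that]])
      have r: "r (p y) \<in> N'" "p (r (p y)) = p y" if "y \<in> N'" for y
        using someI[of "\<lambda>z. z \<in> N' \<and> p z = p y" y] that unfolding r_def by auto
      have b: "y = f (b y) \<oplus>\<^bsub>N\<^esub> r (p y)" if y: "y \<in> N'" for y
      proof -
        have "\<exists>m. m \<in> carrier M \<and> y = f m \<oplus>\<^bsub>N\<^esub> r (p y)"
          using p_eq[of y "r (p y)"] r[OF y] N'E(2) y by auto
        from someI_ex[OF this] show ?thesis unfolding b_def by blast
      qed
      have einj: "inj_on e (carrier N1)"
      proof (rule inj_onI)
        fix x y assume xy: "x \<in> carrier N1" "y \<in> carrier N1" "e x = e y"
        then have N': "x \<in> N'" "y \<in> N'" and "b x = b y" and "c (p x) = c (p y)"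
          by (simp_all add: e_def)
        moreover from this have "p x = p y" using c by metis
        ultimately show "x = y" using b by metis
      qed
      interpret T: transport_module R N1 e
        using modN1 einj by (simp add: transport_module_def transport_module_axioms_def)
      have f1: "f \<in> mod_hom R M N1"
        by (rule mod_homI) (auto simp: fN' mod_homD[OF f])
      define f' where "f' = (\<lambda>m. e (f m))"
      have f': "f' \<in> mod_hom R M T.T" unfolding f'_def by (rule mod_hom_comp[OF f1 T.e_hom])
      have f'inj: "inj_on f' (carrier M)"
        unfolding f'_def using comp_inj_on[OF inj inj_on_subset[OF einj]] fN' by (auto simp: comp_def)
      interpret Q: mono_module R M T.T f'
        using M T.T_module f' f'inj by (simp add: mono_module_def mono_module_axioms_def)
      have "S_pure_mono R S M f' T.T"
        using fpi T.T_module f' f'inj by (simp add: S_FP_injective_def)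
      then have lift: "\<forall>h \<in> mod_hom R ?L Q.C. \<exists>k \<in> mod_hom R ?L T.T. \<forall>x\<in>carrier ?L. Q.p (k x) = h x"
        using fp short_exact_Hom_iff[OF Q.coker_exact L.localization_module]
        unfolding S_pure_mono_def S_pure_exact_def by blast
      have eT: "e y \<in> carrier T.T" if "y \<in> N'" for y using mod_homD(1)[OF T.e_hom] that by simp
      have Qp: "Q.p (e y) = Q.p (e z) \<longleftrightarrow> p y = p z" if yz: "y \<in> N'" "z \<in> N'" for y z
      proof -
        have "e y = f' m \<oplus>\<^bsub>T.T\<^esub> e z \<longleftrightarrow> y = f m \<oplus>\<^bsub>N\<^esub> z" if m: "m \<in> carrier M" for m
        proof -
          have mz: "f m \<oplus>\<^bsub>N\<^esub> z \<in> N'" using N.submoduleE(5)[OF sub fN'[OF m] yz(2)] .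
          have "f' m \<oplus>\<^bsub>T.T\<^esub> e z = e (f m \<oplus>\<^bsub>N\<^esub> z)"
            using mod_homD(2)[OF T.e_hom, of "f m" z] yz fN'[OF m] by (simp add: f'_def)
          then show ?thesis using inj_on_eq_iff[OF einj, of y "f m \<oplus>\<^bsub>N\<^esub> z"] mz yz by simp
        qed
        then show ?thesis using Q.p_eq[OF eT[OF yz(1)] eT[OF yz(2)]] p_eq[OF N'E(2) N'E(2)] yz by simp
      qed
      define y where "y = (\<lambda>x. SOME y. y \<in> carrier N \<and> p y = h x)"
      have y: "y x \<in> N'" "p (y x) = h x" if x: "x \<in> carrier ?L" for x
      proof -
        have "\<exists>y. y \<in> carrier N \<and> p y = h x" using mod_homD(1)[OF h x] by (auto simp: C_carrier)
        then have "y x \<in> carrier N \<and> p (y x) = h x" unfolding y_def by (rule someI_ex)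
        then show "y x \<in> N'" "p (y x) = h x" using x by (auto simp: N'_def)
      qed
      have "(\<lambda>x. Q.p (e (y x))) \<in> mod_hom R ?L Q.C"
      proof (rule mod_homI)
        fix x assume "x \<in> carrier ?L"
        then show "Q.p (e (y x)) \<in> carrier Q.C" using y eT by (auto simp: Q.C_carrier)
      next
        fix x z assume xz: "x \<in> carrier ?L" "z \<in> carrier ?L"
        have "p (y (x \<oplus>\<^bsub>?L\<^esub> z)) = p (y x \<oplus>\<^bsub>N\<^esub> y z)"
          using xz y N'E(2) by (simp add: mod_homD[OF h] mod_homD[OF p_hom])
        then have "Q.p (e (y (x \<oplus>\<^bsub>?L\<^esub> z))) = Q.p (e (y x \<oplus>\<^bsub>N\<^esub> y z))"
          using xz y N.submoduleE(5)[OF sub] by (subst Qp) auto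
        also have "\<dots> = Q.p (e (y x)) \<oplus>\<^bsub>Q.C\<^esub> Q.p (e (y z))"
          using xz y eT mod_homD(2)[OF T.e_hom] by (simp add: Q.C_add)
        finally show "Q.p (e (y (x \<oplus>\<^bsub>?L\<^esub> z))) = Q.p (e (y x)) \<oplus>\<^bsub>Q.C\<^esub> Q.p (e (y z))" .
      next
        fix t x assume tx: "t \<in> carrier R" "x \<in> carrier ?L"
        have "p (y (t \<odot>\<^bsub>?L\<^esub> x)) = p (t \<odot>\<^bsub>N\<^esub> y x)"
          using tx y N'E(2) by (simp add: mod_homD[OF h] mod_homD[OF p_hom])
        then have "Q.p (e (y (t \<odot>\<^bsub>?L\<^esub> x))) = Q.p (e (t \<odot>\<^bsub>N\<^esub> y x))"
          using tx y N.submoduleE(4)[OF sub] by (subst Qp) auto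
        also have "\<dots> = t \<odot>\<^bsub>Q.C\<^esub> Q.p (e (y x))"
          using tx y eT mod_homD(3)[OF T.e_hom] by (simp add: Q.C_smult)
        finally show "Q.p (e (y (t \<odot>\<^bsub>?L\<^esub> x))) = t \<odot>\<^bsub>Q.C\<^esub> Q.p (e (y x))" .
      qed
      from bspec[OF lift this] obtain k where k: "k \<in> mod_hom R ?L T.T"
        "\<And>x. x \<in> carrier ?L \<Longrightarrow> Q.p (k x) = Q.p (e (y x))" by auto
      have dk: "(\<lambda>x. T.d (k x)) \<in> mod_hom R ?L N1" by (rule mod_hom_comp[OF k(1) T.d_hom])
      then have "(\<lambda>x. T.d (k x)) \<in> mod_hom R ?L N"
        using N'E(2) by (auto simp: mod_hom_def)
      moreover have "p (T.d (k x)) = h x" if x: "x \<in> carrier ?L" for x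
      proof -
        have "k x \<in> e ` N'" using mod_homD(1)[OF k(1) x] by (simp add: transport_def)
        then obtain z where z: "z \<in> N'" "k x = e z" by blast
        then have "p z = p (y x)" using k(2)[OF x] Qp y(1)[OF x] by simp
        then show ?thesis using z y(2)[OF x] T.d_e[of z] by simp
      qed
      ultimately show "\<exists>k\<in>mod_hom R ?L N. \<forall>x\<in>carrier ?L. p (k x) = h x"
        by (intro bexI[of _ "\<lambda>x. T.d (k x)"] ballI)
    qed
  qed
qed

end

theory Submission
  imports Defs
begin

text \<open>
  Let \<open>F\<close> be a free module and \<open>F \<rightarrow> P\<^sub>S\<close> a surjection with kernel \<open>K\<close>. Every map from \<open>P\<^sub>S\<close> to the cokernel of
  every monomorphism out of \<open>M\<close> lifts iff every homomorphism from \<open>K\<close> to \<open>M\<close> extends to \<open>F\<close>; both say that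
  the first Ext module of \<open>P\<^sub>S\<close> and \<open>M\<close> vanishes. The extension property is checked componentwise for products and
  passes to retracts. If \<open>R\<^sub>S\<close> is finitely presented, then so is \<open>P\<^sub>S\<close>, so \<open>F\<close> can be chosen with \<open>K\<close> finitely
  generated; a homomorphism from \<open>K\<close> to the direct sum then has nonzero components at finitely many indices only,
  and extending those and taking zero elsewhere lands in the direct sum.
\<close>

text \<open>The definition tests \<open>M\<close> against modules \<open>N\<close> whose carrier
  type depends on that of \<open>M\<close>, so a factor and the product containing it meet different
  test objects. The extension property removes this dependence: \<open>F\<close> and
  \<open>K\<close> come from \<open>P\<^sub>S\<close> alone, and only the target varies. The two
  halves of the equivalence are asymmetric. From extension to lifting, \<open>F\<close> has to be
  free, but one cover of each \<open>P\<^sub>S\<close> is enough. From lifting to extension, every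
  module \<open>F\<close> mapping onto \<open>P\<^sub>S\<close> is allowed. So the cover can be
  picked to suit the module under test, and modules already known to be S-FP-injective have the
  extension property for it. For sums the obstacle is the finite generation of \<open>K\<close>. If
  r/s dies in \<open>P\<^sub>S\<close>, then r itself need not be a relation of \<open>P\<close>;
  only u r is, for some u in \<open>S\<close>. Writing r/s as (u r)/(u s) absorbs the factor u,
  because \<open>R\<^sub>S\<close> contains the inverse of u s.\<close>

section \<open>Factoring homomorphisms through surjections and injections\<close>

lemma mod_hom_diff:
  assumes "module R M" "module R N" "u \<in> mod_hom R M N" "v \<in> mod_hom R M N"
  shows "(\<lambda>x. u x \<ominus>\<^bsub>N\<^esub> v x) \<in> mod_hom R M N"
proof -
  interpret M: module R M by fact
  interpret N: module R N by fact
  note D = mod_homD[OF assms(3)] mod_homD[OF assms(4)]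
  show ?thesis
    by (rule mod_homI)
      (simp_all add: D a_minus_def N.smult_r_distr N.smult_r_minus N.M.minus_add N.M.a_ac)
qed

lemma mod_hom_zero_map: "module R M \<Longrightarrow> module R N \<Longrightarrow> (\<lambda>x. \<zero>\<^bsub>N\<^esub>) \<in> mod_hom R M N"
  by (auto intro!: mod_homI simp: module.smult_r_null module_def abelian_group_def
      abelian_monoid.zero_closed abelian_monoid.l_zero)

text \<open>Compose \<chi> with a set-theoretic section of \<psi>. The kernel condition makes the
  value independent of the chosen preimage, and this independence is what makes the composite
  linear.\<close>

lemma mod_hom_factor:
  assumes M: "module R M" and L: "module R L" and N: "module R N"
    and \<psi>: "\<psi> \<in> mod_hom R M L" "\<psi> ` carrier M = carrier L"
    and \<chi>: "\<chi> \<in> mod_hom R M N"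
    and ker: "\<And>a. a \<in> carrier M \<Longrightarrow> \<psi> a = \<zero>\<^bsub>L\<^esub> \<Longrightarrow> \<chi> a = \<zero>\<^bsub>N\<^esub>"
  obtains h where "h \<in> mod_hom R L N" "\<And>a. a \<in> carrier M \<Longrightarrow> h (\<psi> a) = \<chi> a"
proof -
  interpret M: module R M by fact
  interpret L: module R L by fact
  interpret N: module R N by fact
  have eq: "\<chi> a = \<chi> b" if "a \<in> carrier M" "b \<in> carrier M" "\<psi> a = \<psi> b" for a b
  proof -
    have "\<psi> (a \<ominus>\<^bsub>M\<^esub> b) = \<zero>\<^bsub>L\<^esub>"
      using that mod_homD(1)[OF \<psi>(1)]
      by (simp add: a_minus_def mod_homD(2)[OF \<psi>(1)] mod_hom_minus[OF M L \<psi>(1)] L.M.r_neg)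
    then have "\<chi> (a \<ominus>\<^bsub>M\<^esub> b) = \<zero>\<^bsub>N\<^esub>" using ker that by simp
    then have "\<chi> a \<oplus>\<^bsub>N\<^esub> \<ominus>\<^bsub>N\<^esub> \<chi> b = \<zero>\<^bsub>N\<^esub>"
      using that by (simp add: a_minus_def mod_homD(2)[OF \<chi>] mod_hom_minus[OF M N \<chi>])
    then show ?thesis
      using N.M.minus_equality[of "\<chi> a" "\<ominus>\<^bsub>N\<^esub> \<chi> b"] that mod_homD(1)[OF \<chi>] by simp
  qed
  define s where "s = inv_into (carrier M) \<psi>"
  have s: "s x \<in> carrier M" "\<psi> (s x) = x" if "x \<in> carrier L" for x
    using that \<psi>(2) unfolding s_def by (simp_all add: inv_into_into f_inv_into_f)
  show thesis
  proof
    show "(\<lambda>x. \<chi> (s x)) \<in> mod_hom R L N"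
    proof (rule mod_homI)
      fix x y assume "x \<in> carrier L" "y \<in> carrier L"
      then show "\<chi> (s (x \<oplus>\<^bsub>L\<^esub> y)) = \<chi> (s x) \<oplus>\<^bsub>N\<^esub> \<chi> (s y)"
        by (subst mod_homD(2)[OF \<chi>, symmetric]) (auto intro!: eq simp: s mod_homD(2)[OF \<psi>(1)])
    next
      fix r x assume "r \<in> carrier R" "x \<in> carrier L"
      then show "\<chi> (s (r \<odot>\<^bsub>L\<^esub> x)) = r \<odot>\<^bsub>N\<^esub> \<chi> (s x)"
        by (subst mod_homD(3)[OF \<chi>, symmetric]) (auto intro!: eq simp: s mod_homD(3)[OF \<psi>(1)])
    qed (simp add: s mod_homD(1)[OF \<chi>])
    show "\<chi> (s (\<psi> a)) = \<chi> a" if "a \<in> carrier M" for a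
      using that mod_homD(1)[OF \<psi>(1)] by (intro eq) (simp_all add: s)
  qed
qed

lemma mod_hom_corestrict:
  assumes M: "module R M" and L: "module R L"
    and f: "f \<in> mod_hom R M N" "inj_on f (carrier M)"
    and \<beta>: "\<beta> \<in> mod_hom R L N" "\<And>x. x \<in> carrier L \<Longrightarrow> \<beta> x \<in> f ` carrier M"
  obtains b where "b \<in> mod_hom R L M" "\<And>x. x \<in> carrier L \<Longrightarrow> f (b x) = \<beta> x"
proof -
  interpret M: module R M by fact
  interpret L: module R L by fact
  define b where "b = (\<lambda>x. inv_into (carrier M) f (\<beta> x))"
  have b: "b x \<in> carrier M" "f (b x) = \<beta> x" if "x \<in> carrier L" for x
    using \<beta>(2)[OF that] unfolding b_def by (simp_all add: inv_into_into f_inv_into_f)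
  have "b \<in> mod_hom R L M"
    by (rule mod_homI)
      (auto intro!: inj_onD[OF f(2)] simp: b mod_homD[OF f(1)] mod_homD[OF \<beta>(1)])
  with b(2) that show thesis by blast
qed

lemma submodule_kernel:
  assumes M: "module R M" and N: "module R N" and h: "h \<in> mod_hom R M N"
  shows "submodule (a_kernel M N h) R M"
proof -
  interpret M: module R M by fact
  interpret N: module R N by fact
  show ?thesis
    by (rule M.submoduleI)
      (auto simp: a_kernel_def' mod_homD[OF h] mod_hom_zero[OF M N h] mod_hom_minus[OF M N h])
qed

section \<open>Free modules, linear combinations and pairs of modules\<close>

text \<open>The index set may be infinite, so that every module is covered by the free module on its
  own carrier. For \<open>{..<n}\<close> this is \<open>free_module R n\<close>.\<close>

definition free_on :: "('r, 'x) ring_scheme \<Rightarrow> 'k set \<Rightarrow> ('r, 'k \<Rightarrow> 'r) module" where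
  "free_on R X = sum_module X (\<lambda>_. regular_module R)"

text \<open>For \<open>x\<close> outside \<open>X\<close> this is the zero vector, which keeps
  \<open>unit_vec_closed\<close> unconditional.\<close>

definition unit_vec :: "('r, 'x) ring_scheme \<Rightarrow> 'k set \<Rightarrow> 'k \<Rightarrow> 'k \<Rightarrow> 'r" where
  "unit_vec R X x = (\<lambda>y\<in>X. if y = x then \<one>\<^bsub>R\<^esub> else \<zero>\<^bsub>R\<^esub>)"

text \<open>The sum runs over the support because \<open>finsum\<close> over an infinite set is zero
  by convention.\<close>

definition lincomb :: "('r, 'x) ring_scheme \<Rightarrow> ('r, 'a) module \<Rightarrow> 'k set \<Rightarrow> ('k \<Rightarrow> 'a) \<Rightarrow> ('k \<Rightarrow> 'r) \<Rightarrow> 'a" where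
  "lincomb R N X y a = (\<Oplus>\<^bsub>N\<^esub>x\<in>{x \<in> X. a x \<noteq> \<zero>\<^bsub>R\<^esub>}. a x \<odot>\<^bsub>N\<^esub> y x)"

lemma free_on_simps:
  "carrier (free_on R X) = {a \<in> X \<rightarrow>\<^sub>E carrier R. finite {x \<in> X. a x \<noteq> \<zero>\<^bsub>R\<^esub>}}"
  "\<zero>\<^bsub>free_on R X\<^esub> = (\<lambda>x\<in>X. \<zero>\<^bsub>R\<^esub>)"
  "a \<oplus>\<^bsub>free_on R X\<^esub> b = (\<lambda>x\<in>X. a x \<oplus>\<^bsub>R\<^esub> b x)"
  "r \<odot>\<^bsub>free_on R X\<^esub> a = (\<lambda>x\<in>X. r \<otimes>\<^bsub>R\<^esub> a x)"
  by (simp_all add: free_on_def sum_module_def prod_module_def regular_module_def)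

lemma free_module_eq: "free_module R n = free_on R {..<n}"
  by (simp add: free_module_def free_on_def sum_module_def prod_module_def)

text \<open>Surjectivity of the restriction map from Hom(F, M) to Hom(K, M). The carrier types of
  \<open>F\<close> and \<open>M\<close> are independent, so one pair \<open>F\<close>,
  \<open>K\<close> can be tested against many targets.\<close>

definition hom_ext :: "('r, 'x) ring_scheme \<Rightarrow> ('r, 'f) module \<Rightarrow> 'f set \<Rightarrow> ('r, 'm) module \<Rightarrow> bool" where
  "hom_ext R F K M \<longleftrightarrow> (\<forall>g\<in>mod_hom R (F\<lparr>carrier := K\<rparr>) M. \<exists>b\<in>mod_hom R F M. \<forall>a\<in>K. b a = g a)"

text \<open>The factors have different carrier types, whereas \<open>prod_module\<close> has a
  single one for all factors.\<close>

definition pair_module :: "('r, 'a) module \<Rightarrow> ('r, 'b) module \<Rightarrow> ('r, 'a \<times> 'b) module" where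
  "pair_module M N =
    \<lparr>carrier = carrier M \<times> carrier N, mult = undefined, one = undefined,
     zero = (\<zero>\<^bsub>M\<^esub>, \<zero>\<^bsub>N\<^esub>),
     add = (\<lambda>x y. (fst x \<oplus>\<^bsub>M\<^esub> fst y, snd x \<oplus>\<^bsub>N\<^esub> snd y)),
     smult = (\<lambda>r x. (r \<odot>\<^bsub>M\<^esub> fst x, r \<odot>\<^bsub>N\<^esub> snd x))\<rparr>"

lemma pair_module_module:
  assumes "module R M" "module R N"
  shows "module R (pair_module M N)"
proof -
  interpret M: module R M by fact
  interpret N: module R N by fact
  show ?thesis
  proof (rule moduleI)
    show "cring R" by (rule M.R.is_cring)
    show "abelian_group (pair_module M N)"
    proof (rule abelian_groupI)
      fix x assume "x \<in> carrier (pair_module M N)"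
      then show "\<exists>y\<in>carrier (pair_module M N). y \<oplus>\<^bsub>pair_module M N\<^esub> x = \<zero>\<^bsub>pair_module M N\<^esub>"
        by (intro bexI[of _ "(\<ominus>\<^bsub>M\<^esub> fst x, \<ominus>\<^bsub>N\<^esub> snd x)"])
          (auto simp: pair_module_def M.M.l_neg N.M.l_neg)
    qed (auto simp: pair_module_def M.M.a_ac N.M.a_ac)
  qed (auto simp: pair_module_def M.smult_l_distr M.smult_r_distr M.smult_assoc1
      N.smult_l_distr N.smult_r_distr N.smult_assoc1)
qed

context cring
begin

lemma free_on_module: "module R (free_on R X)"
  by (simp add: free_on_def sum_module_module regular_module_module is_cring)

lemma unit_vec_closed [simp]: "unit_vec R X x \<in> carrier (free_on R X)"
  by (auto simp: unit_vec_def free_on_simps intro: finite_subset[of _ "{x}"])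

text \<open>Induction on a finite set \<open>Y\<close> containing the support: setting one
  coordinate to zero shrinks \<open>Y\<close>, and the lost part is a scaled unit vector.\<close>

lemma free_on_induct [consumes 1, case_names zero add]:
  assumes a: "a \<in> carrier (free_on R X)"
    and zero: "P \<zero>\<^bsub>free_on R X\<^esub>"
    and add: "\<And>b r x. b \<in> carrier (free_on R X) \<Longrightarrow> r \<in> carrier R \<Longrightarrow> x \<in> X \<Longrightarrow> P b \<Longrightarrow>
      P (b \<oplus>\<^bsub>free_on R X\<^esub> r \<odot>\<^bsub>free_on R X\<^esub> unit_vec R X x)"
  shows "P a"
proof -
  have "\<forall>a\<in>carrier (free_on R X). {x \<in> X. a x \<noteq> \<zero>} \<subseteq> Y \<longrightarrow> P a" if "finite Y" for Y
    using that
  proof (induction Y)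
    case empty
    have "a = \<zero>\<^bsub>free_on R X\<^esub>" if "a \<in> carrier (free_on R X)" "{x \<in> X. a x \<noteq> \<zero>} \<subseteq> {}" for a
      using that by (auto simp: free_on_simps PiE_iff extensional_def)
    with zero show ?case by auto
  next
    case (insert z Y)
    show ?case
    proof (intro ballI impI)
      fix a assume a: "a \<in> carrier (free_on R X)" "{x \<in> X. a x \<noteq> \<zero>} \<subseteq> insert z Y"
      show "P a"
      proof (cases "z \<in> X")
        case False
        with a insert.IH show ?thesis by auto
      next
        case True
        define b where "b = a(z := \<zero>)"
        have "finite {x \<in> X. b x \<noteq> \<zero>}"
          using a by (auto simp: free_on_simps b_def intro: finite_subset[of _ "{x \<in> X. a x \<noteq> \<zero>}"])
        then have b: "b \<in> carrier (free_on R X)"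
          using a True by (auto simp: free_on_simps b_def PiE_iff extensional_def)
        have "{x \<in> X. b x \<noteq> \<zero>} \<subseteq> Y" using a by (auto simp: b_def)
        with b insert.IH have "P b" by blast
        moreover have az: "a z \<in> carrier R" using a True by (auto simp: free_on_simps)
        ultimately have "P (b \<oplus>\<^bsub>free_on R X\<^esub> a z \<odot>\<^bsub>free_on R X\<^esub> unit_vec R X z)"
          using add b True by blast
        also have "b \<oplus>\<^bsub>free_on R X\<^esub> a z \<odot>\<^bsub>free_on R X\<^esub> unit_vec R X z = a"
          using a az by (auto simp: free_on_simps b_def unit_vec_def PiE_iff extensional_def)
        finally show ?thesis .
      qed
    qed
  qed
  from this[of "{x \<in> X. a x \<noteq> \<zero>}"] a show ?thesis by (auto simp: free_on_simps)
qed

lemma free_on_hom_eqI: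
  assumes N: "module R N" and u: "u \<in> mod_hom R (free_on R X) N" and v: "v \<in> mod_hom R (free_on R X) N"
    and eq: "\<And>x. x \<in> X \<Longrightarrow> u (unit_vec R X x) = v (unit_vec R X x)"
    and a: "a \<in> carrier (free_on R X)"
  shows "u a = v a"
proof -
  interpret F: module R "free_on R X" by (rule free_on_module)
  show ?thesis
    using a
  proof (induction rule: free_on_induct)
    case zero
    show ?case by (simp add: mod_hom_zero[OF free_on_module N u] mod_hom_zero[OF free_on_module N v])
  next
    case (add b r x)
    then show ?case by (simp add: mod_homD(2,3)[OF u] mod_homD(2,3)[OF v] eq)
  qed
qed

text \<open>Terms off the support vanish. Additivity of \<open>lincomb\<close> relies on this: the
  supports of two elements and of their sum differ, so all three sums are rewritten over one common
  set.\<close>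

lemma lincomb_superset:
  assumes N: "module R N" and y: "y \<in> X \<rightarrow> carrier N" and a: "a \<in> X \<rightarrow> carrier R"
    and Y: "finite Y" "Y \<subseteq> X" "{x \<in> X. a x \<noteq> \<zero>} \<subseteq> Y"
  shows "lincomb R N X y a = (\<Oplus>\<^bsub>N\<^esub>x\<in>Y. a x \<odot>\<^bsub>N\<^esub> y x)"
proof -
  interpret N: module R N by fact
  show ?thesis
    unfolding lincomb_def
  proof (rule N.M.add.finprod_mono_neutral_cong_left)
    show "a i \<odot>\<^bsub>N\<^esub> y i = \<zero>\<^bsub>N\<^esub>" if "i \<in> Y - {x \<in> X. a x \<noteq> \<zero>}" for i
      using that Y y by (auto simp: Pi_iff)
    show "(\<lambda>x. a x \<odot>\<^bsub>N\<^esub> y x) \<in> Y \<rightarrow> carrier N"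
      using y a Y by auto
  qed (use Y in auto)
qed

lemma lincomb_hom:
  assumes N: "module R N" and y: "y \<in> X \<rightarrow> carrier N"
  shows "lincomb R N X y \<in> mod_hom R (free_on R X) N"
proof -
  interpret N: module R N by fact
  interpret F: module R "free_on R X" by (rule free_on_module)
  let ?s = "\<lambda>a. {x \<in> X. a x \<noteq> \<zero>}"
  have F: "a \<in> X \<rightarrow> carrier R" "finite (?s a)" if "a \<in> carrier (free_on R X)" for a
    using that by (auto simp: free_on_simps)
  show ?thesis
  proof (rule mod_homI)
    fix a assume "a \<in> carrier (free_on R X)"
    from F[OF this] show "lincomb R N X y a \<in> carrier N"
      unfolding lincomb_def using y by (intro N.M.finsum_closed) auto
  next
    fix a b assume ab: "a \<in> carrier (free_on R X)" "b \<in> carrier (free_on R X)"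
    note a = F[OF ab(1)] and b = F[OF ab(2)] and c = F[OF F.M.a_closed[OF ab]]
    let ?Y = "?s a \<union> ?s b"
    have Y: "finite ?Y" "?Y \<subseteq> X" using a b by auto
    have "lincomb R N X y (a \<oplus>\<^bsub>free_on R X\<^esub> b) = (\<Oplus>\<^bsub>N\<^esub>x\<in>?Y. (a \<oplus>\<^bsub>free_on R X\<^esub> b) x \<odot>\<^bsub>N\<^esub> y x)"
      by (rule lincomb_superset[OF N y c(1) Y]) (auto simp: free_on_simps)
    also have "\<dots> = (\<Oplus>\<^bsub>N\<^esub>x\<in>?Y. a x \<odot>\<^bsub>N\<^esub> y x \<oplus>\<^bsub>N\<^esub> b x \<odot>\<^bsub>N\<^esub> y x)"
    proof (rule N.M.finsum_cong')
      show "(\<lambda>x. a x \<odot>\<^bsub>N\<^esub> y x \<oplus>\<^bsub>N\<^esub> b x \<odot>\<^bsub>N\<^esub> y x) \<in> ?Y \<rightarrow> carrier N"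
        using a b y by (auto simp: Pi_iff)
      show "(a \<oplus>\<^bsub>free_on R X\<^esub> b) x \<odot>\<^bsub>N\<^esub> y x = a x \<odot>\<^bsub>N\<^esub> y x \<oplus>\<^bsub>N\<^esub> b x \<odot>\<^bsub>N\<^esub> y x" if "x \<in> ?Y" for x
        using that a b y by (auto simp: free_on_simps Pi_iff N.smult_l_distr)
    qed simp
    also have "\<dots> = (\<Oplus>\<^bsub>N\<^esub>x\<in>?Y. a x \<odot>\<^bsub>N\<^esub> y x) \<oplus>\<^bsub>N\<^esub> (\<Oplus>\<^bsub>N\<^esub>x\<in>?Y. b x \<odot>\<^bsub>N\<^esub> y x)"
      using a b y by (intro N.M.finsum_addf) (auto simp: Pi_iff)
    also have "\<dots> = lincomb R N X y a \<oplus>\<^bsub>N\<^esub> lincomb R N X y b"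
      using lincomb_superset[OF N y a(1) Y] lincomb_superset[OF N y b(1) Y] by simp
    finally show "lincomb R N X y (a \<oplus>\<^bsub>free_on R X\<^esub> b) = lincomb R N X y a \<oplus>\<^bsub>N\<^esub> lincomb R N X y b" .
  next
    fix r a assume ra: "r \<in> carrier R" "a \<in> carrier (free_on R X)"
    note a = F[OF ra(2)] and c = F[OF F.smult_closed[OF ra]]
    have Y: "finite (?s a)" "?s a \<subseteq> X" using a by auto
    have "lincomb R N X y (r \<odot>\<^bsub>free_on R X\<^esub> a) = (\<Oplus>\<^bsub>N\<^esub>x\<in>?s a. (r \<odot>\<^bsub>free_on R X\<^esub> a) x \<odot>\<^bsub>N\<^esub> y x)"
      by (rule lincomb_superset[OF N y c(1) Y]) (use ra in \<open>auto simp: free_on_simps\<close>)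
    also have "\<dots> = (\<Oplus>\<^bsub>N\<^esub>x\<in>?s a. r \<odot>\<^bsub>N\<^esub> (a x \<odot>\<^bsub>N\<^esub> y x))"
      using ra a y by (intro N.M.finsum_cong') (auto simp: free_on_simps Pi_iff N.smult_assoc1)
    also have "\<dots> = r \<odot>\<^bsub>N\<^esub> lincomb R N X y a"
      unfolding lincomb_def using ra a y by (intro N.finsum_smult_ldistr[symmetric]) (auto simp: Pi_iff)
    finally show "lincomb R N X y (r \<odot>\<^bsub>free_on R X\<^esub> a) = r \<odot>\<^bsub>N\<^esub> lincomb R N X y a" .
  qed
qed

lemma lincomb_unit_vec:
  assumes N: "module R N" and y: "y \<in> X \<rightarrow> carrier N" and x: "x \<in> X"
  shows "lincomb R N X y (unit_vec R X x) = y x"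
proof -
  interpret N: module R N by fact
  \<comment> \<open>Summing over \<open>{x}\<close> also covers the zero ring, where the support of
    the unit vector is empty.\<close>
  have "lincomb R N X y (unit_vec R X x) = (\<Oplus>\<^bsub>N\<^esub>z\<in>{x}. unit_vec R X x z \<odot>\<^bsub>N\<^esub> y z)"
    by (rule lincomb_superset[OF N y]) (use x in \<open>auto simp: unit_vec_def split: if_splits\<close>)
  also have "\<dots> = y x" using x y by (subst N.M.finsum_insert) (auto simp: unit_vec_def Pi_iff)
  finally show ?thesis .
qed


section \<open>Lifting through cokernels and extending from kernels\<close>

text \<open>Freeness lifts the composite of \<psi> and \<open>h\<close> to a map \<eta> from the
  free module to \<open>N\<close>. The obstruction to \<eta> descending to \<open>L\<close> is its
  restriction to the kernel, which takes values in the image of \<open>M\<close> since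
  \<open>h\<close> kills zero. Extending this restriction to \<open>b\<close> on the whole free
  module and subtracting it removes the obstruction; the image in the cokernel stays the same,
  because \<open>b\<close> takes values in \<open>M\<close>.\<close>

lemma lift_of_hom_ext:
  assumes mono: "mono_module R M N f" and L: "module R L" and h: "h \<in> mod_hom R L (coker M f N)"
    and \<psi>: "\<psi> \<in> mod_hom R (free_on R X) L" "\<psi> ` carrier (free_on R X) = carrier L"
    and ext: "hom_ext R (free_on R X) (a_kernel (free_on R X) L \<psi>) M"
  shows "\<exists>k\<in>mod_hom R L N. \<forall>x\<in>carrier L. coker_proj M f N (k x) = h x"
proof -
  let ?F = "free_on R X" and ?K = "a_kernel (free_on R X) L \<psi>"
  interpret mono_module R M N f by fact
  interpret L: module R L by fact
  interpret F: module R ?F by (rule free_on_module)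
  note M = M.module_axioms and N = N.module_axioms and F = F.module_axioms
  have K_mod: "module R (?F\<lparr>carrier := ?K\<rparr>)"
    by (rule submodule.submodule_is_module[OF submodule_kernel[OF F L \<psi>(1)] F])
  have KF: "a \<in> carrier ?F" "\<psi> a = \<zero>\<^bsub>L\<^esub>" if "a \<in> ?K" for a
    using that by (auto simp: a_kernel_def')
  define y where "y = (\<lambda>x. SOME n. n \<in> carrier N \<and> p n = h (\<psi> (unit_vec R X x)))"
  have y: "y x \<in> carrier N" "p (y x) = h (\<psi> (unit_vec R X x))" for x
  proof -
    have "h (\<psi> (unit_vec R X x)) \<in> carrier C"
      by (intro mod_homD(1)[OF h] mod_homD(1)[OF \<psi>(1)]) simp
    then have "\<exists>n. n \<in> carrier N \<and> p n = h (\<psi> (unit_vec R X x))" by (auto simp: C_carrier)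
    from someI_ex[OF this] show "y x \<in> carrier N" "p (y x) = h (\<psi> (unit_vec R X x))"
      by (simp_all add: y_def)
  qed
  define \<eta> where "\<eta> = lincomb R N X y"
  have \<eta>: "\<eta> \<in> mod_hom R ?F N" unfolding \<eta>_def by (rule lincomb_hom[OF N]) (simp add: y)
  have p\<eta>: "p (\<eta> a) = h (\<psi> a)" if "a \<in> carrier ?F" for a
  proof (rule free_on_hom_eqI[OF C_module mod_hom_comp[OF \<eta> p_hom] mod_hom_comp[OF \<psi>(1) h] _ that])
    fix x assume "x \<in> X"
    then show "p (\<eta> (unit_vec R X x)) = h (\<psi> (unit_vec R X x))"
      unfolding \<eta>_def by (subst lincomb_unit_vec[OF N]) (auto simp: y)
  qed
  have "\<eta> \<in> mod_hom R (?F\<lparr>carrier := ?K\<rparr>) N"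
    using \<eta> KF by (auto simp: mod_hom_def)
  moreover have "\<eta> a \<in> f ` carrier M" if "a \<in> carrier (?F\<lparr>carrier := ?K\<rparr>)" for a
  proof -
    have a: "a \<in> carrier ?F" "\<psi> a = \<zero>\<^bsub>L\<^esub>" using KF that by auto
    then have "p (\<eta> a) = \<zero>\<^bsub>C\<^esub>" using p\<eta> mod_hom_zero[OF L C_module h] by simp
    moreover have "f ` carrier M = a_kernel N C p" using coker_exact by (simp add: short_exact_def)
    ultimately show ?thesis using mod_homD(1)[OF \<eta> a(1)] by (simp add: a_kernel_def')
  qed
  ultimately obtain g where g: "g \<in> mod_hom R (?F\<lparr>carrier := ?K\<rparr>) M"
    and fg: "\<And>a. a \<in> ?K \<Longrightarrow> f (g a) = \<eta> a"
    using mod_hom_corestrict[OF M K_mod f inj] by auto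
  from g ext obtain b where b: "b \<in> mod_hom R ?F M" "\<And>a. a \<in> ?K \<Longrightarrow> b a = g a"
    unfolding hom_ext_def by blast
  note fb = mod_hom_comp[OF b(1) f]
  have "\<eta> a \<ominus>\<^bsub>N\<^esub> f (b a) = \<zero>\<^bsub>N\<^esub>" if "a \<in> carrier ?F" "\<psi> a = \<zero>\<^bsub>L\<^esub>" for a
  proof -
    have "a \<in> ?K" using that by (simp add: a_kernel_def')
    then show ?thesis using b(2) fg mod_homD(1)[OF \<eta> that(1)] by (simp add: a_minus_def N.M.r_neg)
  qed
  then obtain k where k: "k \<in> mod_hom R L N" "\<And>a. a \<in> carrier ?F \<Longrightarrow> k (\<psi> a) = \<eta> a \<ominus>\<^bsub>N\<^esub> f (b a)"
    using mod_hom_factor[OF F L N \<psi> mod_hom_diff[OF F N \<eta> fb]] by blast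
  have "p (k x) = h x" if x: "x \<in> carrier L" for x
  proof -
    obtain a where a: "a \<in> carrier ?F" "x = \<psi> a" using x \<psi>(2) by blast
    have c: "\<eta> a \<in> carrier N" "b a \<in> carrier M" "f (b a) \<in> carrier N"
      using a mod_homD(1)[OF \<eta>] mod_homD(1)[OF b(1)] mod_homD(1)[OF f] by auto
    have "\<eta> a \<ominus>\<^bsub>N\<^esub> f (b a) = f (\<ominus>\<^bsub>M\<^esub> b a) \<oplus>\<^bsub>N\<^esub> \<eta> a"
      using c by (simp add: mod_hom_minus[OF M N f] a_minus_def N.M.a_comm)
    then have "p (k x) = p (\<eta> a)"
      using c a k(2) by (subst p_eq) (auto intro!: bexI[of _ "\<ominus>\<^bsub>M\<^esub> b a"] simp: mod_homD(1)[OF f])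
    then show ?thesis using p\<eta> a by simp
  qed
  with k(1) show ?thesis by blast
qed

end

text \<open>
  The module \<open>N\<close> in the premise is the pushout of \<open>M\<close> and \<open>F\<close> along the kernel \<open>K\<close> of \<open>\<psi>\<close>, i.e. the
  quotient of \<open>M \<times> F\<close> by all \<open>(g a, a)\<close>, \<open>a \<in> K\<close>; its quotient by \<open>M\<close> is \<open>F/K\<close>, which is isomorphic
  to \<open>L\<close>. The graph is taken without a sign, so \<open>(0, a)\<close> is identified with \<open>(- g a, 0)\<close>.
\<close>

lemma hom_ext_of_lift:
  fixes F :: "('r, 'f) module" and M :: "('r, 'm) module"
  assumes M: "module R M" and L: "module R L" and F: "module R F"
    and \<psi>: "\<psi> \<in> mod_hom R F L" "\<psi> ` carrier F = carrier L"
    and lift: "\<And>(N :: ('r, ('m \<times> 'f) set) module) f h. mono_module R M N f \<Longrightarrow> h \<in> mod_hom R L (coker M f N) \<Longrightarrow>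
      \<exists>k\<in>mod_hom R L N. \<forall>x\<in>carrier L. coker_proj M f N (k x) = h x"
  shows "hom_ext R F (a_kernel F L \<psi>) M"
  unfolding hom_ext_def
proof
  let ?K = "a_kernel F L \<psi>"
  let ?FK = "F\<lparr>carrier := ?K\<rparr>"
  fix g assume g: "g \<in> mod_hom R ?FK M"
  have K_mod: "module R ?FK"
    by (rule submodule.submodule_is_module[OF submodule_kernel[OF F L \<psi>(1)] F])
  interpret M: module R M by fact
  interpret L: module R L by fact
  interpret F: module R F by fact
  interpret K: module R ?FK by (rule K_mod)
  have KF: "a \<in> ?K \<longleftrightarrow> a \<in> carrier F \<and> \<psi> a = \<zero>\<^bsub>L\<^esub>" for a
    by (auto simp: a_kernel_def')
  let ?MF = "pair_module M F"
  define q where "q = (\<lambda>a. (g a, a))"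
  \<comment> \<open>The graph map \<open>q\<close> is a monomorphism, so its cokernel
    \<open>Q.C\<close> is the pushout and the cokernel calculus applies to it. Its elements are
    cosets of pairs, whence the carrier type of \<open>N\<close> in \<open>lift\<close>.\<close>
  interpret Q: mono_module R ?FK ?MF q
  proof (intro mono_module.intro mono_module_axioms.intro K_mod pair_module_module[OF M F])
    show "q \<in> mod_hom R ?FK ?MF"
      by (rule mod_homI) (use mod_homD[OF g] KF in \<open>auto simp: q_def pair_module_def\<close>)
    show "inj_on q (carrier ?FK)" by (auto simp: q_def inj_on_def)
  qed
  define f where "f = (\<lambda>m. Q.p (m, \<zero>\<^bsub>F\<^esub>))"
  define j where "j = (\<lambda>a. Q.p (\<zero>\<^bsub>M\<^esub>, a))"
  have f: "f \<in> mod_hom R M Q.C"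
    unfolding f_def by (intro mod_hom_comp[OF _ Q.p_hom] mod_homI) (auto simp: pair_module_def)
  have j: "j \<in> mod_hom R F Q.C"
    unfolding j_def by (intro mod_hom_comp[OF _ Q.p_hom] mod_homI) (auto simp: pair_module_def)
  \<comment> \<open>If (m, 0) and (n, 0) differ by (g a, a), the second component forces a = 0,
    hence g a = 0.\<close>
  have finj: "inj_on f (carrier M)"
  proof (rule inj_onI)
    fix m n assume mn: "m \<in> carrier M" "n \<in> carrier M" "f m = f n"
    then obtain a where a: "a \<in> ?K" "(m, \<zero>\<^bsub>F\<^esub>) = q a \<oplus>\<^bsub>?MF\<^esub> (n, \<zero>\<^bsub>F\<^esub>)"
      unfolding f_def by (subst (asm) Q.p_eq) (auto simp: pair_module_def)
    then have "a = \<zero>\<^bsub>F\<^esub>" using KF by (simp add: q_def pair_module_def)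
    then show "m = n" using a mn mod_hom_zero[OF K_mod M g] by (simp add: q_def pair_module_def)
  qed
  interpret E: mono_module R M Q.C f
    using M Q.C_module f finj by (simp add: mono_module_def mono_module_axioms_def)
  have jK: "j a = f (\<ominus>\<^bsub>M\<^esub> g a)" if a: "a \<in> ?K" for a
  proof -
    have ga: "g a \<in> carrier M" using mod_homD(1)[OF g] a by simp
    then show ?thesis
      unfolding j_def f_def using a KF
      by (subst Q.p_eq) (auto intro!: bexI[of _ a] simp: pair_module_def q_def M.M.r_neg)
  qed
  have "E.p (j a) = \<zero>\<^bsub>E.C\<^esub>" if "a \<in> carrier F" "\<psi> a = \<zero>\<^bsub>L\<^esub>" for a
  proof -
    have a: "a \<in> ?K" using that KF by blast
    have ga: "g a \<in> carrier M" using mod_homD(1)[OF g] a by simp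
    have "f ` carrier M = a_kernel Q.C E.C E.p" using E.coker_exact by (simp add: short_exact_def)
    then have "f (\<ominus>\<^bsub>M\<^esub> g a) \<in> a_kernel Q.C E.C E.p" using ga by blast
    then show ?thesis using jK[OF a] by (simp add: a_kernel_def')
  qed
  then obtain h where h: "h \<in> mod_hom R L E.C" "\<And>a. a \<in> carrier F \<Longrightarrow> h (\<psi> a) = E.p (j a)"
    using mod_hom_factor[OF F L E.C_module \<psi> mod_hom_comp[OF j E.p_hom]] by blast
  from lift[OF E.mono_module_axioms h(1)] obtain k where k: "k \<in> mod_hom R L Q.C"
    "\<And>x. x \<in> carrier L \<Longrightarrow> E.p (k x) = h x" by blast
  note k\<psi> = mod_hom_comp[OF \<psi>(1) k(1)]
  \<comment> \<open>\<open>k\<close> after \<psi> and \<open>j\<close> induce the same map to the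
    cokernel of \<open>f\<close>, so their difference comes from \<open>M\<close>. On the kernel the
    first vanishes and \<open>j\<close> equals -f g, so there the difference is f g: it is the
    desired extension.\<close>
  have "k (\<psi> a) \<ominus>\<^bsub>Q.C\<^esub> j a \<in> f ` carrier M" if a: "a \<in> carrier F" for a
  proof -
    note c = mod_homD(1)[OF k\<psi> a] mod_homD(1)[OF j a]
    have "E.p (k (\<psi> a)) = E.p (j a)" using a k(2) h(2) mod_homD(1)[OF \<psi>(1)] by simp
    then obtain m where m: "m \<in> carrier M" "k (\<psi> a) = f m \<oplus>\<^bsub>Q.C\<^esub> j a" using E.p_eq[OF c] by auto
    then have "k (\<psi> a) \<ominus>\<^bsub>Q.C\<^esub> j a = f m"
      using c mod_homD(1)[OF f m(1)] by (simp add: a_minus_def E.N.M.a_assoc E.N.M.r_neg)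
    then show ?thesis using m by blast
  qed
  then obtain b where b: "b \<in> mod_hom R F M" "\<And>a. a \<in> carrier F \<Longrightarrow> f (b a) = k (\<psi> a) \<ominus>\<^bsub>Q.C\<^esub> j a"
    using mod_hom_corestrict[OF M F f finj mod_hom_diff[OF F Q.C_module k\<psi> j]] by blast
  have "b a = g a" if a: "a \<in> ?K" for a
  proof (rule inj_onD[OF finj])
    have aF: "a \<in> carrier F" "\<psi> a = \<zero>\<^bsub>L\<^esub>" using a KF by auto
    have ga: "g a \<in> carrier M" using mod_homD(1)[OF g] a by simp
    show "f (b a) = f (g a)"
      using b(2)[OF aF(1)] aF ga jK[OF a] mod_homD(1)[OF f ga] mod_hom_zero[OF L Q.C_module k(1)]
      by (simp add: a_minus_def mod_hom_minus[OF M Q.C_module f])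
    show "b a \<in> carrier M" "g a \<in> carrier M" using mod_homD(1)[OF b(1) aF(1)] ga by auto
  qed
  with b(1) show "\<exists>b\<in>mod_hom R F M. \<forall>a\<in>?K. b a = g a" by blast
qed

section \<open>S-FP-injectivity as an extension property\<close>

text \<open>The pushout has another carrier type than the modules in the definition of
  \<open>S_FP_injective\<close>, and \<open>P\<close> may have any type.
  \<open>S_FP_injective_any_type\<close> and \<open>S_pure_exact_any_type\<close> bridge the two
  gaps.\<close>

lemma S_FP_injective_hom_ext:
  fixes M :: "('r, 'm) module" and F :: "('r, 'f) module"
  assumes S: "submonoid S R" and fpi: "S_FP_injective R S M" and P: "finitely_presented R P"
    and F: "module R F" and \<psi>: "\<psi> \<in> mod_hom R F (localization R S P)"
      "\<psi> ` carrier F = carrier (localization R S P)"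
  shows "hom_ext R F (a_kernel F (localization R S P) \<psi>) M"
proof (rule hom_ext_of_lift[OF _ _ F \<psi>])
  let ?L = "localization R S P"
  show M: "module R M" using fpi by (simp add: S_FP_injective_def)
  show L: "module R ?L"
    using P S by (intro loc_module.localization_module) (simp add: loc_module_def finitely_presented_def)
  fix N :: "('r, ('m \<times> 'f) set) module" and f h
  assume "mono_module R M N f" and h: "h \<in> mod_hom R ?L (coker M f N)"
  then interpret mono_module R M N f by simp
  have "S_pure_mono R S M f N"
    by (rule S_FP_injective_any_type[OF S fpi N.module_axioms f inj])
  from S_pure_exact_any_type[OF S this[unfolded S_pure_mono_def] P]
  show "\<exists>k\<in>mod_hom R ?L N. \<forall>x\<in>carrier ?L. coker_proj M f N (k x) = h x"
    unfolding short_exact_Hom_iff[OF coker_exact L] using h by blast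
qed

text \<open>One free cover per \<open>P\<close> suffices, and it is left open which: products and
  retracts use the free module on the carrier of the localization, sums a finite free one.\<close>

lemma S_FP_injectiveI:
  fixes M :: "('r, 'm) module"
  assumes S: "submonoid S R" and M: "module R M"
    and cover: "\<And>P :: ('r, (nat \<Rightarrow> 'r) set) module. finitely_presented R P \<Longrightarrow>
      \<exists>(X :: 'k set) \<psi>. \<psi> \<in> mod_hom R (free_on R X) (localization R S P) \<and>
        \<psi> ` carrier (free_on R X) = carrier (localization R S P) \<and>
        hom_ext R (free_on R X) (a_kernel (free_on R X) (localization R S P) \<psi>) M"
  shows "S_FP_injective R S M"
  unfolding S_FP_injective_def
proof (intro conjI allI impI M)
  fix N :: "('r, 'm \<times> 'r list) module" and f
  assume N: "module R N \<and> f \<in> mod_hom R M N \<and> inj_on f (carrier M)"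
  interpret mono_module R M N f
    using M N by (simp add: mono_module_def mono_module_axioms_def)
  show "S_pure_mono R S M f N"
    unfolding S_pure_mono_def S_pure_exact_def
  proof (intro conjI allI impI coker_exact)
    fix P :: "('r, (nat \<Rightarrow> 'r) set) module" assume P: "finitely_presented R P"
    let ?L = "localization R S P"
    have L: "module R ?L"
      using P S by (intro loc_module.localization_module) (simp add: loc_module_def finitely_presented_def)
    obtain X :: "'k set" and \<psi> where \<psi>: "\<psi> \<in> mod_hom R (free_on R X) ?L"
      "\<psi> ` carrier (free_on R X) = carrier ?L" "hom_ext R (free_on R X) (a_kernel (free_on R X) ?L \<psi>) M"
      using cover[OF P] by blast
    show "short_exact R (Hom_module R ?L M) (compose (carrier ?L) f) (Hom_module R ?L N)
        (compose (carrier ?L) p) (Hom_module R ?L C)"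
      unfolding short_exact_Hom_iff[OF coker_exact L]
      using M.R.lift_of_hom_ext[OF mono_module_axioms L _ \<psi>] by blast
  qed
qed

lemma (in cring) free_on_cover:
  assumes L: "module R L"
  defines "\<psi> \<equiv> lincomb R L (carrier L) (\<lambda>x. x)"
  shows "\<psi> \<in> mod_hom R (free_on R (carrier L)) L" "\<psi> ` carrier (free_on R (carrier L)) = carrier L"
proof -
  show hom: "\<psi> \<in> mod_hom R (free_on R (carrier L)) L"
    unfolding \<psi>_def by (rule lincomb_hom[OF L]) auto
  have "x \<in> \<psi> ` carrier (free_on R (carrier L))" if "x \<in> carrier L" for x
    using that lincomb_unit_vec[OF L, of "\<lambda>x. x" "carrier L" x] unfolding \<psi>_def
    by (intro image_eqI[of _ _ "unit_vec R (carrier L) x"]) auto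
  then show "\<psi> ` carrier (free_on R (carrier L)) = carrier L"
    using mod_homD(1)[OF hom] by blast
qed

lemma S_FP_injectiveI_cover:
  fixes M :: "('r, 'm) module"
  assumes S: "submonoid S R" and M: "module R M"
    and ext: "\<And>(P :: ('r, (nat \<Rightarrow> 'r) set) module) (F :: ('r, ((nat \<Rightarrow> 'r) set \<times> 'r) set \<Rightarrow> 'r) module) \<psi>.
      finitely_presented R P \<Longrightarrow> module R F \<Longrightarrow> \<psi> \<in> mod_hom R F (localization R S P) \<Longrightarrow>
      \<psi> ` carrier F = carrier (localization R S P) \<Longrightarrow>
      hom_ext R F (a_kernel F (localization R S P) \<psi>) M"
  shows "S_FP_injective R S M"
proof (rule S_FP_injectiveI[OF S M])
  interpret M: module R M by fact
  fix P :: "('r, (nat \<Rightarrow> 'r) set) module" assume P: "finitely_presented R P"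
  let ?L = "localization R S P"
  have "module R ?L"
    using P S by (intro loc_module.localization_module) (simp add: loc_module_def finitely_presented_def)
  note \<psi> = M.R.free_on_cover[OF this]
  show "\<exists>(X :: ((nat \<Rightarrow> 'r) set \<times> 'r) set set) \<psi>. \<psi> \<in> mod_hom R (free_on R X) ?L \<and>
      \<psi> ` carrier (free_on R X) = carrier ?L \<and> hom_ext R (free_on R X) (a_kernel (free_on R X) ?L \<psi>) M"
    by (intro exI[of _ "carrier ?L"] exI[of _ "lincomb R ?L (carrier ?L) (\<lambda>x. x)"] conjI \<psi>
        ext[OF P M.R.free_on_module \<psi>])
qed

section \<open>Retracts, products and direct summands\<close>

text \<open>Push \<open>g\<close> into \<open>M'\<close> along \<open>i\<close>, extend it there and
  return along \<open>q\<close>.\<close>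

lemma hom_ext_retract:
  assumes ext: "hom_ext R F K M'" and i: "i \<in> mod_hom R M M'" and q: "q \<in> mod_hom R M' M"
    and qi: "\<And>m. m \<in> carrier M \<Longrightarrow> q (i m) = m"
  shows "hom_ext R F K M"
  unfolding hom_ext_def
proof
  fix g assume g: "g \<in> mod_hom R (F\<lparr>carrier := K\<rparr>) M"
  obtain b where b: "b \<in> mod_hom R F M'" "\<And>a. a \<in> K \<Longrightarrow> b a = i (g a)"
    using bspec[OF ext[unfolded hom_ext_def] mod_hom_comp[OF g i]] by auto
  have "q (b a) = g a" if "a \<in> K" for a
    using that b(2) qi mod_homD(1)[OF g] by simp
  then show "\<exists>b\<in>mod_hom R F M. \<forall>a\<in>K. b a = g a"
    by (intro bexI[OF _ mod_hom_comp[OF b(1) q]] ballI)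
qed

lemma S_FP_injective_retract:
  assumes S: "submonoid S R" and M: "module R M" and fpi: "S_FP_injective R S M'"
    and i: "i \<in> mod_hom R M M'" and q: "q \<in> mod_hom R M' M"
    and qi: "\<And>m. m \<in> carrier M \<Longrightarrow> q (i m) = m"
  shows "S_FP_injective R S M"
  by (rule S_FP_injectiveI_cover[OF S M])
    (rule hom_ext_retract[OF S_FP_injective_hom_ext[OF S fpi] i q qi])

lemma hom_ext_prod_module:
  assumes F: "module R F" and M: "\<And>i. i \<in> I \<Longrightarrow> module R (M i)"
    and ext: "\<And>i. i \<in> I \<Longrightarrow> hom_ext R F K (M i)"
  shows "hom_ext R F K (prod_module I M)"
  unfolding hom_ext_def
proof
  fix g assume g: "g \<in> mod_hom R (F\<lparr>carrier := K\<rparr>) (prod_module I M)"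
  have gi: "(\<lambda>a. g a i) \<in> mod_hom R (F\<lparr>carrier := K\<rparr>) (M i)" if "i \<in> I" for i
    using that mod_homD[OF g] by (intro mod_homI) (auto simp: prod_module_def PiE_iff)
  then have "\<forall>i\<in>I. \<exists>b\<in>mod_hom R F (M i). \<forall>a\<in>K. b a = g a i"
    using ext by (auto simp: hom_ext_def)
  then obtain b where b: "\<And>i. i \<in> I \<Longrightarrow> b i \<in> mod_hom R F (M i)"
    "\<And>i a. i \<in> I \<Longrightarrow> a \<in> K \<Longrightarrow> b i a = g a i" by metis
  show "\<exists>b\<in>mod_hom R F (prod_module I M). \<forall>a\<in>K. b a = g a"
  proof (intro bexI ballI)
    show "(\<lambda>a. \<lambda>i\<in>I. b i a) \<in> mod_hom R F (prod_module I M)"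
      by (rule mod_homI) (auto simp: prod_module_def mod_homD[OF b(1)])
    show "(\<lambda>i\<in>I. b i a) = g a" if "a \<in> K" for a
      using that b(2) mod_homD(1)[OF g, of a] by (auto simp: prod_module_def PiE_iff extensional_def)
  qed
qed

lemma S_FP_injective_prod_module:
  assumes R: "cring R" and S: "submonoid S R" and fpi: "\<And>i. i \<in> I \<Longrightarrow> S_FP_injective R S (M i)"
  shows "S_FP_injective R S (prod_module I M)"
proof -
  have M: "module R (M i)" if "i \<in> I" for i using fpi[OF that] by (simp add: S_FP_injective_def)
  show ?thesis
    by (rule S_FP_injectiveI_cover[OF S prod_module_module[OF R M]])
      (auto intro!: hom_ext_prod_module M S_FP_injective_hom_ext[OF S fpi])
qed

text \<open>Insertion at coordinate \<open>i\<close> has at most one nonzero entry, so it lands in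
  the sum as well as in the product. With the projection it makes \<open>M i\<close> a retract of
  both.\<close>

lemma S_FP_injective_factor:
  assumes R: "cring R" and S: "submonoid S R" and M: "\<And>i. i \<in> I \<Longrightarrow> module R (M i)" and i: "i \<in> I"
    and fpi: "S_FP_injective R S (prod_module I M) \<or> S_FP_injective R S (sum_module I M)"
  shows "S_FP_injective R S (M i)"
proof -
  interpret Mi: module R "M i" by (rule M[OF i])
  have ag: "abelian_group (M j)" if "j \<in> I" for j using M[OF that] by (simp add: module_def)
  have zero: "\<zero>\<^bsub>M j\<^esub> \<in> carrier (M j)" "\<zero>\<^bsub>M j\<^esub> \<oplus>\<^bsub>M j\<^esub> \<zero>\<^bsub>M j\<^esub> = \<zero>\<^bsub>M j\<^esub>"
    "r \<in> carrier R \<Longrightarrow> r \<odot>\<^bsub>M j\<^esub> \<zero>\<^bsub>M j\<^esub> = \<zero>\<^bsub>M j\<^esub>" if "j \<in> I" for j r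
    using ag[OF that] module.smult_r_null[OF M[OF that]]
    by (simp_all add: abelian_group_def abelian_monoid.zero_closed abelian_monoid.l_zero)
  define e where "e = (\<lambda>m. \<lambda>j\<in>I. if j = i then m else \<zero>\<^bsub>M j\<^esub>)"
  have e: "e \<in> mod_hom R (M i) (prod_module I M)"
    by (rule mod_homI) (auto simp: e_def prod_module_def zero)
  have "finite {j \<in> I. e m j \<noteq> \<zero>\<^bsub>M j\<^esub>}" for m
    by (rule finite_subset[of _ "{i}"]) (auto simp: e_def)
  with e have e': "e \<in> mod_hom R (M i) (sum_module I M)"
    by (auto simp: mod_hom_def sum_module_def)
  have q: "(\<lambda>x. x i) \<in> mod_hom R (prod_module I M) (M i)"
    using i by (intro mod_homI) (auto simp: prod_module_def)
  then have q': "(\<lambda>x. x i) \<in> mod_hom R (sum_module I M) (M i)"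
    by (auto simp: mod_hom_def sum_module_def)
  from fpi show ?thesis
  proof
    assume "S_FP_injective R S (prod_module I M)"
    from S_FP_injective_retract[OF S M[OF i] this e q] i show ?thesis by (simp add: e_def)
  next
    assume "S_FP_injective R S (sum_module I M)"
    from S_FP_injective_retract[OF S M[OF i] this e' q'] i show ?thesis by (simp add: e_def)
  qed
qed

text \<open>The projection onto \<open>A\<close> along \<open>B\<close> makes \<open>A\<close> a
  retract of \<open>N\<close>. It is chosen pointwise; uniqueness of the components gives its
  linearity.\<close>

lemma S_FP_injective_direct_summand:
  assumes S: "submonoid S R" and fpi: "S_FP_injective R S N"
    and A: "submodule A R N" and B: "submodule B R N"
    and AB: "A \<inter> B = {\<zero>\<^bsub>N\<^esub>}" "A <+>\<^bsub>N\<^esub> B = carrier N"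
  shows "S_FP_injective R S (N\<lparr>carrier := A\<rparr>)"
proof -
  have N: "module R N" using fpi by (simp add: S_FP_injective_def)
  interpret N: module R N by fact
  let ?A = "N\<lparr>carrier := A\<rparr>"
  have Amod: "module R ?A" by (rule submodule.submodule_is_module[OF A N])
  interpret A: module R ?A by (rule Amod)
  note subA = N.submoduleE[OF A] and subB = N.submoduleE[OF B]
  have dec: "\<exists>a\<in>A. \<exists>b\<in>B. x = a \<oplus>\<^bsub>N\<^esub> b" if "x \<in> carrier N" for x
    using that unfolding AB(2)[symmetric] by (auto simp: set_add_def')
  define q where "q = (\<lambda>x. SOME a. a \<in> A \<and> (\<exists>b\<in>B. x = a \<oplus>\<^bsub>N\<^esub> b))"
  have q: "q x \<in> A" "\<exists>b\<in>B. x = q x \<oplus>\<^bsub>N\<^esub> b" if "x \<in> carrier N" for x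
    using someI_ex[of "\<lambda>a. a \<in> A \<and> (\<exists>b\<in>B. x = a \<oplus>\<^bsub>N\<^esub> b)"] dec[OF that] by (auto simp: q_def)
  have AN: "a \<in> carrier N" if "a \<in> A" for a using that subA(1) by blast
  have BN: "b \<in> carrier N" if "b \<in> B" for b using that subB(1) by blast
  have uniq: "a = a'" if "a \<in> A" "a' \<in> A" "b \<in> B" "b' \<in> B" "a \<oplus>\<^bsub>N\<^esub> b = a' \<oplus>\<^bsub>N\<^esub> b'" for a a' b b'
  proof -
    note c = AN[OF that(1)] AN[OF that(2)] BN[OF that(3)] BN[OF that(4)]
    \<comment> \<open>Comparing the two decompositions turns the difference of the parts in
      \<open>A\<close> into a difference of parts in \<open>B\<close>, so it lies in the trivial
      intersection.\<close>
    have "a \<oplus>\<^bsub>N\<^esub> \<ominus>\<^bsub>N\<^esub> a' = (a \<oplus>\<^bsub>N\<^esub> b) \<oplus>\<^bsub>N\<^esub> (\<ominus>\<^bsub>N\<^esub> b \<oplus>\<^bsub>N\<^esub> \<ominus>\<^bsub>N\<^esub> a')"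
      using c by (simp add: N.M.a_assoc N.M.r_neg2)
    also have "\<dots> = (a' \<oplus>\<^bsub>N\<^esub> \<ominus>\<^bsub>N\<^esub> a') \<oplus>\<^bsub>N\<^esub> (b' \<oplus>\<^bsub>N\<^esub> \<ominus>\<^bsub>N\<^esub> b)"
      unfolding that(5) using c by (simp add: N.M.a_ac del: N.M.r_neg)
    also have "\<dots> = b' \<oplus>\<^bsub>N\<^esub> \<ominus>\<^bsub>N\<^esub> b" using c by (simp add: N.M.r_neg)
    finally have "a \<oplus>\<^bsub>N\<^esub> \<ominus>\<^bsub>N\<^esub> a' \<in> A \<inter> B"
      using subA(3,5) subB(3,5) that(1-4) by (metis IntI)
    then have "a \<oplus>\<^bsub>N\<^esub> \<ominus>\<^bsub>N\<^esub> a' = \<zero>\<^bsub>N\<^esub>" using AB(1) by blast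
    then show ?thesis using N.M.minus_equality[of a "\<ominus>\<^bsub>N\<^esub> a'"] c by simp
  qed
  have qI: "q x = a" if "a \<in> A" "b \<in> B" "x = a \<oplus>\<^bsub>N\<^esub> b" for x a b
  proof -
    have "x \<in> carrier N" using that AN BN by simp
    from q[OF this] show ?thesis using uniq that by metis
  qed
  have "q \<in> mod_hom R N ?A"
  proof (rule mod_homI)
    fix x y assume xy: "x \<in> carrier N" "y \<in> carrier N"
    obtain b c where bc: "b \<in> B" "x = q x \<oplus>\<^bsub>N\<^esub> b" "c \<in> B" "y = q y \<oplus>\<^bsub>N\<^esub> c"
      using q(2) xy by metis
    have "x \<oplus>\<^bsub>N\<^esub> y = (q x \<oplus>\<^bsub>N\<^esub> b) \<oplus>\<^bsub>N\<^esub> (q y \<oplus>\<^bsub>N\<^esub> c)" using bc by simp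
    also have "\<dots> = (q x \<oplus>\<^bsub>N\<^esub> q y) \<oplus>\<^bsub>N\<^esub> (b \<oplus>\<^bsub>N\<^esub> c)"
      using q(1) xy bc(1,3) AN BN by (simp add: N.M.a_ac)
    finally show "q (x \<oplus>\<^bsub>N\<^esub> y) = q x \<oplus>\<^bsub>?A\<^esub> q y"
      using qI q(1) xy bc(1,3) subA(5) subB(5) by simp
  next
    fix r x assume rx: "r \<in> carrier R" "x \<in> carrier N"
    obtain b where b: "b \<in> B" "x = q x \<oplus>\<^bsub>N\<^esub> b" using q(2) rx by metis
    have "r \<odot>\<^bsub>N\<^esub> x = r \<odot>\<^bsub>N\<^esub> (q x \<oplus>\<^bsub>N\<^esub> b)" using b by simp
    also have "\<dots> = r \<odot>\<^bsub>N\<^esub> q x \<oplus>\<^bsub>N\<^esub> r \<odot>\<^bsub>N\<^esub> b"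
      using q(1) rx b(1) AN BN by (simp add: N.smult_r_distr)
    finally show "q (r \<odot>\<^bsub>N\<^esub> x) = r \<odot>\<^bsub>?A\<^esub> q x"
      using qI q(1) rx b(1) subA(4) subB(4) by simp
  qed (simp add: q)
  moreover have "(\<lambda>x. x) \<in> mod_hom R ?A N" by (rule mod_homI) (simp_all add: AN)
  moreover have "q x = x" if "x \<in> A" for x
    using that AN AB(1) by (intro qI[of _ "\<zero>\<^bsub>N\<^esub>"]) auto
  ultimately show ?thesis using S_FP_injective_retract[OF S Amod fpi, of "\<lambda>x. x" q] by simp
qed

section \<open>Finitely many generators and relations for the localization of
  \<open>P\<close>\<close>

lemma (in cring) free_on_hom_submodule:
  assumes N: "module R N" and H: "submodule H R N" and \<kappa>: "\<kappa> \<in> mod_hom R (free_on R Y) N"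
    and gen: "\<And>y. y \<in> Y \<Longrightarrow> \<kappa> (unit_vec R Y y) \<in> H" and a: "a \<in> carrier (free_on R Y)"
  shows "\<kappa> a \<in> H"
proof -
  interpret F: module R "free_on R Y" by (rule free_on_module)
  interpret N: module R N by fact
  note H' = N.submoduleE[OF H]
  from H'(2) obtain x where x: "x \<in> H" by blast
  then have "\<zero>\<^bsub>R\<^esub> \<odot>\<^bsub>N\<^esub> x \<in> H" by (intro H') auto
  moreover have "x \<in> carrier N" using x H'(1) by blast
  ultimately have zero: "\<zero>\<^bsub>N\<^esub> \<in> H" by simp
  show ?thesis
    using a
  proof (induction rule: free_on_induct)
    case zero
    show ?case using \<open>\<zero>\<^bsub>N\<^esub> \<in> H\<close> by (simp add: mod_hom_zero[OF free_on_module N \<kappa>])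
  next
    case (add b r x)
    then show ?case by (simp add: mod_homD(2,3)[OF \<kappa>] H'(4,5) gen)
  qed
qed

text \<open>Denominators are multiplied together one at a time. Over \<open>R\<^sub>S\<close> a
  single \<open>s\<close> lets a family of n fractions be read as one pure tensor of a vector r in
  \<open>R\<^sup>n\<close> with 1/s.\<close>

lemma (in loc_module) common_denominator:
  fixes n :: nat
  assumes "\<And>j. j < n \<Longrightarrow> w j \<in> carrier (localization R S M)"
  shows "\<exists>s\<in>S. \<exists>m. \<forall>j<n. m j \<in> carrier M \<and> w j = frac (m j) s"
  using assms
proof (induction n)
  case 0
  show ?case by (intro bexI[of _ \<one>]) auto
next
  case (Suc n)
  then obtain s m where s: "s \<in> S" and m: "\<And>j. j < n \<Longrightarrow> m j \<in> carrier M"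
    "\<And>j. j < n \<Longrightarrow> w j = frac (m j) s" by (metis less_Suc_eq)
  obtain m' s' where m': "m' \<in> carrier M" "s' \<in> S" "w n = frac m' s'"
    using Suc.prems[of n] by (auto elim: loc_cases)
  show ?case
  proof (intro bexI[of _ "s \<otimes> s'"] exI[of _ "\<lambda>j. if j = n then s \<odot>\<^bsub>M\<^esub> m' else s' \<odot>\<^bsub>M\<^esub> m j"] allI impI)
    fix j assume "j < Suc n"
    moreover have "frac m' s' = frac (s \<odot>\<^bsub>M\<^esub> m') (s \<otimes> s')"
      using s m' by (intro frac_eqI[of _ _ _ _ \<one>]) (auto simp: smult_assoc1[symmetric] m_ac)
    moreover have "frac (m j) s = frac (s' \<odot>\<^bsub>M\<^esub> m j) (s \<otimes> s')" if "j < n"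
      using s m' m(1)[OF that] by (intro frac_eqI[of _ _ _ _ \<one>]) (auto simp: smult_assoc1[symmetric] m_ac)
    ultimately show "(if j = n then s \<odot>\<^bsub>M\<^esub> m' else s' \<odot>\<^bsub>M\<^esub> m j) \<in> carrier M \<and>
        w j = frac (if j = n then s \<odot>\<^bsub>M\<^esub> m' else s' \<odot>\<^bsub>M\<^esub> m j) (s \<otimes> s')"
      using s m m' by (auto simp: less_Suc_eq)
  qed (use s m' in auto)
qed

text \<open>This is the bilinear map sending p and t/s to (t p)/s, which identifies the tensor
  product of \<open>M\<close> and \<open>R\<^sub>S\<close> with the localization of
  \<open>M\<close>. For fixed p it is the localization of the map sending t to t p, hence well
  defined; linearity in p is checked on fractions.\<close>

lemma (in loc_module) loc_pairing:
  obtains \<mu> where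
    "\<And>p. p \<in> carrier M \<Longrightarrow> \<mu> p \<in> mod_hom R (localization R S (regular_module R)) (localization R S M)"
    "\<And>w. w \<in> carrier (localization R S (regular_module R)) \<Longrightarrow> (\<lambda>p. \<mu> p w) \<in> mod_hom R M (localization R S M)"
    "\<And>p t s. p \<in> carrier M \<Longrightarrow> t \<in> carrier R \<Longrightarrow> s \<in> S \<Longrightarrow>
      \<mu> p (loc_frac R S (regular_module R) t s) = frac (t \<odot>\<^bsub>M\<^esub> p) s"
proof -
  let ?Q = "regular_module R"
  have Q: "carrier ?Q = carrier R" by (simp add: regular_module_def)
  note Qmod = regular_module_module[OF R.is_cring]
  interpret Q: loc_module R ?Q S using Qmod S.submonoid_axioms by (simp add: loc_module_def)
  have "\<forall>p\<in>carrier M. \<exists>v. v \<in> mod_hom R (localization R S ?Q) (localization R S M) \<and>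
      (\<forall>t\<in>carrier R. \<forall>s\<in>S. v (loc_frac R S ?Q t s) = frac (t \<odot>\<^bsub>M\<^esub> p) s)"
  proof
    fix p assume p: "p \<in> carrier M"
    have "(\<lambda>t. t \<odot>\<^bsub>M\<^esub> p) \<in> mod_hom R ?Q M"
      using p by (intro mod_homI) (auto simp: regular_module_def smult_l_distr smult_assoc1)
    from loc_map[OF Qmod module_axioms S.submonoid_axioms this]
    show "\<exists>v. v \<in> mod_hom R (localization R S ?Q) (localization R S M) \<and>
        (\<forall>t\<in>carrier R. \<forall>s\<in>S. v (loc_frac R S ?Q t s) = frac (t \<odot>\<^bsub>M\<^esub> p) s)"
      unfolding Q by metis
  qed
  from bchoice[OF this] obtain \<mu> where
    \<mu>: "\<And>p. p \<in> carrier M \<Longrightarrow> \<mu> p \<in> mod_hom R (localization R S ?Q) (localization R S M)"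
      "\<And>p t s. p \<in> carrier M \<Longrightarrow> t \<in> carrier R \<Longrightarrow> s \<in> S \<Longrightarrow>
        \<mu> p (loc_frac R S ?Q t s) = frac (t \<odot>\<^bsub>M\<^esub> p) s"
    by metis
  moreover have "(\<lambda>p. \<mu> p w) \<in> mod_hom R M (localization R S M)"
    if w: "w \<in> carrier (localization R S ?Q)" for w
  proof -
    obtain t s where ts: "t \<in> carrier R" "s \<in> S" "w = loc_frac R S ?Q t s"
      using w unfolding Q[symmetric] by (rule Q.loc_cases)
    show ?thesis
    proof (rule mod_homI)
      fix p q assume pq: "p \<in> carrier M" "q \<in> carrier M"
      have "frac (t \<odot>\<^bsub>M\<^esub> (p \<oplus>\<^bsub>M\<^esub> q)) s = frac (s \<odot>\<^bsub>M\<^esub> (t \<odot>\<^bsub>M\<^esub> p) \<oplus>\<^bsub>M\<^esub> s \<odot>\<^bsub>M\<^esub> (t \<odot>\<^bsub>M\<^esub> q)) (s \<otimes> s)"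
        using pq ts by (intro frac_eqI[of _ _ _ _ \<one>]) (auto simp: smult_r_distr smult_assoc1[symmetric] m_ac)
      then show "\<mu> (p \<oplus>\<^bsub>M\<^esub> q) w = \<mu> p w \<oplus>\<^bsub>localization R S M\<^esub> \<mu> q w"
        using pq ts by (simp add: \<mu>(2) add_frac)
    next
      fix r p assume rp: "r \<in> carrier R" "p \<in> carrier M"
      then show "\<mu> (r \<odot>\<^bsub>M\<^esub> p) w = r \<odot>\<^bsub>localization R S M\<^esub> \<mu> p w"
        using ts by (simp add: \<mu>(2) smult_frac smult_assoc1[symmetric] m_ac)
    qed (use ts in \<open>simp add: \<mu>(2)\<close>)
  qed
  ultimately show thesis using that by blast
qed

text \<open>
  Presentations \<open>R\<^sup>m \<rightarrow> R\<^sup>n \<rightarrow> P\<close> and \<open>R\<^sup>b \<rightarrow> R\<^sup>a \<rightarrow> R\<^sub>S\<close> give a surjection from \<open>R\<^sup>n \<otimes> R\<^sup>a\<close>, the free module on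
  the pairs \<open>(j, l)\<close>, onto \<open>P \<otimes> R\<^sub>S\<close>, i.e. the localization of \<open>P\<close>. Its kernel is generated by the
  relations of each factor tensored with the generators of the other; \<open>\<tau> r z\<close> below is the pure
  tensor of \<open>r\<close> and \<open>z\<close>.
\<close>

lemma localization_fg_cover:
  fixes P :: "('r, 'p) module" and R :: "('r, 'x) ring_scheme"
  assumes S: "submonoid S R" and RS: "finitely_presented R (localization R S (regular_module R))"
    and P: "finitely_presented R P"
  obtains X :: "(nat \<times> nat) set" and \<psi> G where
    "\<psi> \<in> mod_hom R (free_on R X) (localization R S P)"
    "\<psi> ` carrier (free_on R X) = carrier (localization R S P)"
    "finite G" "G \<subseteq> a_kernel (free_on R X) (localization R S P) \<psi>"
    "\<And>H. submodule H R (free_on R X) \<Longrightarrow> G \<subseteq> H \<Longrightarrow> a_kernel (free_on R X) (localization R S P) \<psi> \<subseteq> H"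
proof -
  let ?Q = "regular_module R"
  let ?LQ = "localization R S ?Q" and ?LP = "localization R S P"
  have Pmod: "module R P" using P by (simp add: finitely_presented_def)
  interpret loc_module R P S using Pmod S by (simp add: loc_module_def)
  have Q: "carrier ?Q = carrier R" "smult ?Q = mult R" by (simp_all add: regular_module_def)
  note Qmod = regular_module_module[OF R.is_cring]
  interpret Q: loc_module R ?Q S using Qmod S by (simp add: loc_module_def)
  note LPmod = localization_module and LQmod = Q.localization_module
  interpret LP: module R ?LP by (rule LPmod)
  interpret LQ: module R ?LQ by (rule LQmod)
  note F = R.free_on_module
  from P[unfolded finitely_presented_def free_module_eq] obtain m n :: nat and \<phi> \<psi> where \<phi>: "\<phi> \<in> mod_hom R (free_on R {..<m}) (free_on R {..<n})"
    and \<psi>: "\<psi> \<in> mod_hom R (free_on R {..<n}) P"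
    and ker: "\<phi> ` carrier (free_on R {..<m}) = a_kernel (free_on R {..<n}) P \<psi>"
    and surj: "\<psi> ` carrier (free_on R {..<n}) = carrier P"
    by (elim conjE exE) (rule that)
  from RS[unfolded finitely_presented_def free_module_eq] obtain b a :: nat and \<phi>' \<psi>' where \<phi>': "\<phi>' \<in> mod_hom R (free_on R {..<b}) (free_on R {..<a})"
    and \<psi>': "\<psi>' \<in> mod_hom R (free_on R {..<a}) ?LQ"
    and ker': "\<phi>' ` carrier (free_on R {..<b}) = a_kernel (free_on R {..<a}) ?LQ \<psi>'"
    and surj': "\<psi>' ` carrier (free_on R {..<a}) = carrier ?LQ"
    by (elim conjE exE) (rule that)
  obtain \<mu> where \<mu>1: "\<And>p. p \<in> carrier P \<Longrightarrow> \<mu> p \<in> mod_hom R ?LQ ?LP"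
    and \<mu>2: "\<And>w. w \<in> carrier ?LQ \<Longrightarrow> (\<lambda>p. \<mu> p w) \<in> mod_hom R P ?LP"
    and \<mu>: "\<And>p t s. p \<in> carrier P \<Longrightarrow> t \<in> carrier R \<Longrightarrow> s \<in> S \<Longrightarrow> \<mu> p (Q.frac t s) = frac (t \<odot>\<^bsub>P\<^esub> p) s"
    by (rule loc_pairing) (rule that)
  let ?Fn = "free_on R {..<n}" and ?Fa = "free_on R {..<a}"
  define X where "X = {..<n} \<times> {..<a}"
  let ?F = "free_on R X"
  have carr: "carrier ?F = X \<rightarrow>\<^sub>E carrier R" "carrier ?Fn = {..<n} \<rightarrow>\<^sub>E carrier R" "carrier ?Fa = {..<a} \<rightarrow>\<^sub>E carrier R"
    by (auto simp: free_on_simps X_def)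
  interpret F: module R ?F by (rule F)
  define \<tau> where "\<tau> = (\<lambda>r z. \<lambda>(j, l)\<in>X. r j \<otimes>\<^bsub>R\<^esub> z l)"
  have \<tau>1: "(\<lambda>z. \<tau> r z) \<in> mod_hom R ?Fa ?F" if "r \<in> carrier ?Fn" for r
    using that by (intro mod_homI)
      (auto simp: carr PiE_iff \<tau>_def X_def free_on_simps R.r_distr R.m_ac intro!: restrict_ext)
  have \<tau>2: "(\<lambda>r. \<tau> r z) \<in> mod_hom R ?Fn ?F" if "z \<in> carrier ?Fa" for z
    using that by (intro mod_homI)
      (auto simp: carr PiE_iff \<tau>_def X_def free_on_simps R.l_distr R.m_assoc intro!: restrict_ext)
  have \<tau>_unit: "\<tau> (unit_vec R {..<n} j) (unit_vec R {..<a} l) = unit_vec R X (j, l)" for j l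
    by (auto simp: \<tau>_def X_def unit_vec_def fun_eq_iff)
  define \<Psi> where "\<Psi> = lincomb R ?LP X (\<lambda>(j, l). \<mu> (\<psi> (unit_vec R {..<n} j)) (\<psi>' (unit_vec R {..<a} l)))"
  have gen_closed: "(\<lambda>(j, l). \<mu> (\<psi> (unit_vec R {..<n} j)) (\<psi>' (unit_vec R {..<a} l))) \<in> X \<rightarrow> carrier ?LP"
    by (auto intro!: mod_homD(1)[OF \<mu>1] mod_homD(1)[OF \<psi>] mod_homD(1)[OF \<psi>'])
  have \<Psi>: "\<Psi> \<in> mod_hom R ?F ?LP" unfolding \<Psi>_def by (rule R.lincomb_hom[OF LPmod gen_closed])
  have \<Psi>_unit: "\<Psi> (unit_vec R X (j, l)) = \<mu> (\<psi> (unit_vec R {..<n} j)) (\<psi>' (unit_vec R {..<a} l))"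
    if "j < n" "l < a" for j l
    unfolding \<Psi>_def using that by (subst R.lincomb_unit_vec[OF LPmod gen_closed]) (auto simp: X_def)
  \<comment> \<open>Both sides are linear in \<open>r\<close> and in \<open>z\<close>, so two nested
    comparisons on unit vectors suffice.\<close>
  have \<Psi>\<tau>: "\<Psi> (\<tau> r z) = \<mu> (\<psi> r) (\<psi>' z)" if r: "r \<in> carrier ?Fn" and z: "z \<in> carrier ?Fa" for r z
  proof (rule R.free_on_hom_eqI[OF LPmod mod_hom_comp[OF \<tau>2[OF z] \<Psi>]
        mod_hom_comp[OF \<psi> \<mu>2[OF mod_homD(1)[OF \<psi>' z]]] _ r])
    fix j assume j: "j \<in> {..<n}"
    let ?e = "unit_vec R {..<n} j"
    show "\<Psi> (\<tau> ?e z) = \<mu> (\<psi> ?e) (\<psi>' z)"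
    proof (rule R.free_on_hom_eqI[OF LPmod mod_hom_comp[OF \<tau>1 \<Psi>] mod_hom_comp[OF \<psi>' \<mu>1] _ z])
      show "\<psi> ?e \<in> carrier P" by (rule mod_homD(1)[OF \<psi>]) simp
    qed (use j in \<open>simp_all add: \<tau>_unit \<Psi>_unit\<close>)
  qed
  \<comment> \<open>The j-th component of \<open>c\<close> when the free module on \<open>X\<close>
    is read as n copies of \<open>R\<^sup>a\<close>; \<open>c\<close> is the sum of the pure tensors
    of the j-th unit vector with \<open>row j c\<close>.\<close>
  define row where "row = (\<lambda>j c. \<lambda>l\<in>{..<a}. (c :: nat \<times> nat \<Rightarrow> 'r) (j, l))"
  have row: "row j \<in> mod_hom R ?F ?Fa" if "j < n" for j
    using that by (intro mod_homI) (auto simp: row_def carr X_def free_on_simps)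
  have row_\<tau>: "row j (\<tau> r z) = r j \<odot>\<^bsub>?Fa\<^esub> z" if "j < n" for j r z
    using that by (auto simp: row_def \<tau>_def X_def free_on_simps)
  have inv: "\<exists>z\<in>carrier ?Fa. \<psi>' z = Q.frac \<one>\<^bsub>R\<^esub> s" if "s \<in> S" for s
  proof -
    have "Q.frac \<one>\<^bsub>R\<^esub> s \<in> carrier ?LQ" using that by (intro Q.frac_closed) (simp_all add: Q)
    then show ?thesis unfolding surj'[symmetric] by auto
  qed
  define G where "G = (\<lambda>(j, t). \<tau> (unit_vec R {..<n} j) (\<phi>' (unit_vec R {..<b} t))) ` ({..<n} \<times> {..<b}) \<union>
    (\<lambda>(i, l). \<tau> (\<phi> (unit_vec R {..<m} i)) (unit_vec R {..<a} l)) ` ({..<m} \<times> {..<a})"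
  have \<phi>_c: "\<phi> (unit_vec R {..<m} i) \<in> carrier ?Fn" "\<psi> (\<phi> (unit_vec R {..<m} i)) = \<zero>\<^bsub>P\<^esub>" for i
    using ker R.unit_vec_closed[of "{..<m}" i] by (auto simp: a_kernel_def')
  have \<phi>'_c: "\<phi>' (unit_vec R {..<b} i) \<in> carrier ?Fa" "\<psi>' (\<phi>' (unit_vec R {..<b} i)) = \<zero>\<^bsub>?LQ\<^esub>" for i
    using ker' R.unit_vec_closed[of "{..<b}" i] by (auto simp: a_kernel_def')
  have G_ker: "G \<subseteq> a_kernel ?F ?LP \<Psi>"
  proof -
    have "\<tau> (unit_vec R {..<n} j) (\<phi>' (unit_vec R {..<b} t)) \<in> a_kernel ?F ?LP \<Psi>" for j t
    proof -
      have "\<psi> (unit_vec R {..<n} j) \<in> carrier P" by (rule mod_homD(1)[OF \<psi>]) simp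
      then show ?thesis
        using mod_homD(1)[OF \<tau>1] \<phi>'_c by (simp add: a_kernel_def' \<Psi>\<tau> mod_hom_zero[OF LQmod LPmod \<mu>1])
    qed
    moreover have "\<tau> (\<phi> (unit_vec R {..<m} i)) (unit_vec R {..<a} l) \<in> a_kernel ?F ?LP \<Psi>" for i l
    proof -
      have "\<psi>' (unit_vec R {..<a} l) \<in> carrier ?LQ" by (rule mod_homD(1)[OF \<psi>']) simp
      then show ?thesis
        using mod_homD(1)[OF \<tau>1] \<phi>_c by (simp add: a_kernel_def' \<Psi>\<tau> mod_hom_zero[OF Pmod LPmod \<mu>2])
    qed
    ultimately show ?thesis by (auto simp: G_def)
  qed
  \<comment> \<open>These \<open>c\<close> are the kernel of the map to n copies of
    \<open>R\<^sub>S\<close> given by \<psi>' on each row. Each row is a relation of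
    \<open>R\<^sub>S\<close>, so the first family in \<open>G\<close> generates it.\<close>
  have rows: "c \<in> H" if H: "submodule H R ?F" "G \<subseteq> H" and c: "c \<in> carrier ?F"
    and z: "\<And>j. j < n \<Longrightarrow> \<psi>' (row j c) = \<zero>\<^bsub>?LQ\<^esub>" for H c
  proof -
    have rowH: "\<tau> (unit_vec R {..<n} j) (row j c) \<in> H" if j: "j < n" for j
    proof -
      have "row j c \<in> \<phi>' ` carrier (free_on R {..<b})"
        using mod_homD(1)[OF row[OF j] c] z[OF j] unfolding ker' by (simp add: a_kernel_def')
      then obtain u where u: "u \<in> carrier (free_on R {..<b})" "row j c = \<phi>' u" by blast
      have "\<tau> (unit_vec R {..<n} j) (\<phi>' u) \<in> H"
        by (rule R.free_on_hom_submodule[OF F H(1) mod_hom_comp[OF \<phi>' \<tau>1] _ u(1)])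
          (use j H(2) in \<open>auto simp: G_def\<close>)
      then show ?thesis by (simp add: u)
    qed
    \<comment> \<open>Rows are added one by one: this is \<open>c\<close> with only its first
      \<open>k\<close> rows kept, and \<open>k = n\<close> gives \<open>c\<close>.\<close>
    have "(\<lambda>(j, l)\<in>X. if j < k then c (j, l) else \<zero>\<^bsub>R\<^esub>) \<in> H" if "k \<le> n" for k
      using that
    proof (induction k)
      case 0
      have "\<zero>\<^bsub>?F\<^esub> \<in> H" using H(1) submodule.axioms(1) subgroup.one_closed by fastforce
      moreover have "\<zero>\<^bsub>?F\<^esub> = (\<lambda>(j, l)\<in>X. if j < 0 then c (j, l) else \<zero>\<^bsub>R\<^esub>)"
        by (auto simp: free_on_simps)
      ultimately show ?case by (simp only:)
    next
      case (Suc k)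
      have cX: "c (j, l) \<in> carrier R" if "j < n" "l < a" for j l
        using c[unfolded carr] that by (auto simp: X_def)
      have "(\<lambda>(j, l)\<in>X. if j < Suc k then c (j, l) else \<zero>\<^bsub>R\<^esub>) =
          (\<lambda>(j, l)\<in>X. if j < k then c (j, l) else \<zero>\<^bsub>R\<^esub>) \<oplus>\<^bsub>?F\<^esub> \<tau> (unit_vec R {..<n} k) (row k c)"
        using cX Suc.prems by (auto simp: free_on_simps \<tau>_def row_def X_def unit_vec_def fun_eq_iff less_Suc_eq)
      then show ?case
        by (rule ssubst) (rule F.submoduleE(5)[OF H(1) Suc.IH rowH]; use Suc.prems in simp)
    qed
    from this[of n] have "(\<lambda>(j, l)\<in>X. if j < n then c (j, l) else \<zero>\<^bsub>R\<^esub>) \<in> H" by simp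
    also have "(\<lambda>(j, l)\<in>X. if j < n then c (j, l) else \<zero>\<^bsub>R\<^esub>) = c"
      using c[unfolded carr] by (auto simp: X_def fun_eq_iff PiE_iff extensional_def)
    finally show ?thesis .
  qed
  show thesis
  proof
    show "\<Psi> \<in> mod_hom R ?F ?LP" by (rule \<Psi>)
    show "\<Psi> ` carrier ?F = carrier ?LP"
    proof (intro equalityI subsetI)
      fix x assume "x \<in> carrier ?LP"
      then obtain p s where ps: "p \<in> carrier P" "s \<in> S" "x = frac p s" by (rule loc_cases)
      obtain r where r: "r \<in> carrier ?Fn" "p = \<psi> r" using ps(1) surj by blast
      obtain z where z: "z \<in> carrier ?Fa" "\<psi>' z = Q.frac \<one>\<^bsub>R\<^esub> s" using inv[OF ps(2)] by blast
      \<comment> \<open>The fraction p/s pairs p with 1/s, so a single pure tensor already hits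
        it.\<close>
      have "\<Psi> (\<tau> r z) = x" using r z ps by (simp add: \<Psi>\<tau> \<mu>)
      then show "x \<in> \<Psi> ` carrier ?F" using mod_homD(1)[OF \<tau>1[OF r(1)] z(1)] by blast
    qed (use mod_homD(1)[OF \<Psi>] in auto)
    show "finite G" by (simp add: G_def)
    show "G \<subseteq> a_kernel ?F ?LP \<Psi>" by (rule G_ker)
    fix H assume H: "submodule H R ?F" "G \<subseteq> H"
    show "a_kernel ?F ?LP \<Psi> \<subseteq> H"
    proof
      fix c assume "c \<in> a_kernel ?F ?LP \<Psi>"
      then have c: "c \<in> carrier ?F" "\<Psi> c = \<zero>\<^bsub>?LP\<^esub>" by (auto simp: a_kernel_def')
      have "\<psi>' (row j c) \<in> carrier ?LQ" if "j < n" for j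
        using mod_homD(1)[OF mod_hom_comp[OF row[OF that] \<psi>'] c(1)] .
      \<comment> \<open>With a common denominator, the image of \<open>c\<close> in n copies of
        \<open>R\<^sub>S\<close> becomes r/s for one vector \<open>r\<close>.\<close>
      from Q.common_denominator[of n "\<lambda>j. \<psi>' (row j c)", OF this]
      obtain s r0 where s: "s \<in> S" and r0: "\<And>j. j < n \<Longrightarrow> r0 j \<in> carrier R"
        "\<And>j. j < n \<Longrightarrow> \<psi>' (row j c) = Q.frac (r0 j) s" by (auto simp: Q)
      define r where "r = restrict r0 {..<n}"
      have r: "r \<in> carrier ?Fn" using r0(1) by (auto simp: r_def carr)
      have rj: "r j \<in> carrier R" if "j < n" for j using that r0(1) by (simp add: r_def)
      have row_c: "\<psi>' (row j c) = Q.frac (r j) s" if "j < n" for j using that r0(2) by (simp add: r_def)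
      have frac_smult: "t \<odot>\<^bsub>?LQ\<^esub> Q.frac \<one>\<^bsub>R\<^esub> v = Q.frac t v" if "t \<in> carrier R" "v \<in> S" for t v
        using that by (simp add: Q.smult_frac Q)
      have row_\<tau>': "\<psi>' (row j (\<tau> r' z)) = Q.frac (r' j) v"
        if "j < n" "r' \<in> carrier ?Fn" "z \<in> carrier ?Fa" "\<psi>' z = Q.frac \<one>\<^bsub>R\<^esub> v" "v \<in> S" for j r' z v
      proof -
        have "r' j \<in> carrier R" using that(1,2) by (auto simp: carr)
        then show ?thesis using that by (simp add: row_\<tau> mod_homD(3)[OF \<psi>'] frac_smult)
      qed
      \<comment> \<open>Stated for any submodule containing \<open>G\<close> because it is used
        twice: for the kernel itself, which yields that \<Psi> vanishes on the pure tensor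
        \<open>\<tau> r z\<close>, and for \<open>H\<close>.\<close>
      have diff: "x \<ominus>\<^bsub>?F\<^esub> y \<in> H'" if H': "submodule H' R ?F" "G \<subseteq> H'"
        and xy: "x \<in> carrier ?F" "y \<in> carrier ?F"
        and eq: "\<And>j. j < n \<Longrightarrow> \<psi>' (row j x) = \<psi>' (row j y)" for H' x y
      proof (rule rows[OF H'])
        fix j assume j: "j < n"
        note h = mod_hom_comp[OF row[OF j] \<psi>']
        show "\<psi>' (row j (x \<ominus>\<^bsub>?F\<^esub> y)) = \<zero>\<^bsub>?LQ\<^esub>"
          using xy eq[OF j] mod_homD(1)[OF h xy(2)]
          by (simp add: a_minus_def mod_homD(2)[OF h] mod_hom_minus[OF F LQmod h] LQ.M.r_neg)
      qed (use xy in simp)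
      obtain z where z: "z \<in> carrier ?Fa" "\<psi>' z = Q.frac \<one>\<^bsub>R\<^esub> s" using inv[OF s] by blast
      have \<tau>_c: "\<tau> r z \<in> carrier ?F" using mod_homD(1)[OF \<tau>1[OF r] z(1)] .
      have eq: "\<psi>' (row j c) = \<psi>' (row j (\<tau> r z))" if "j < n" for j
        using that row_c row_\<tau>'[OF that r z s] by simp
      have "c \<ominus>\<^bsub>?F\<^esub> \<tau> r z \<in> a_kernel ?F ?LP \<Psi>"
        by (rule diff[OF submodule_kernel[OF F LPmod \<Psi>] G_ker c(1) \<tau>_c eq])
      then have "\<ominus>\<^bsub>?LP\<^esub> \<Psi> (\<tau> r z) = \<zero>\<^bsub>?LP\<^esub>"
        using c \<tau>_c mod_homD(1)[OF \<Psi> \<tau>_c]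
        by (simp add: a_kernel_def' a_minus_def mod_homD(2)[OF \<Psi>] mod_hom_minus[OF F LPmod \<Psi>])
      then have "\<Psi> (\<tau> r z) = \<zero>\<^bsub>?LP\<^esub>"
        using LP.M.l_neg[of "\<Psi> (\<tau> r z)"] mod_homD(1)[OF \<Psi> \<tau>_c] by simp
      moreover have \<psi>r: "\<psi> r \<in> carrier P" by (rule mod_homD(1)[OF \<psi> r])
      ultimately have "frac (\<psi> r) s = frac \<zero>\<^bsub>P\<^esub> \<one>\<^bsub>R\<^esub>" using r z s by (simp add: \<Psi>\<tau> \<mu> zero_loc)
      then obtain u where u: "u \<in> S" "u \<odot>\<^bsub>P\<^esub> \<psi> r = \<zero>\<^bsub>P\<^esub>"
        using \<psi>r s by (subst (asm) frac_eq) auto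
      interpret Fn: module R ?Fn by (rule F)
      \<comment> \<open>Unlike \<open>r\<close>, the multiple \<open>u r\<close> is a relation of
        \<open>P\<close>, so the second family in \<open>G\<close> puts its pure tensors into
        \<open>H\<close>. As r/s = (u r)/(u s), pairing \<open>r'\<close> with a preimage
        \<open>z'\<close> of 1/(u s) still matches the rows of \<open>c\<close>.\<close>
      define r' where "r' = u \<odot>\<^bsub>?Fn\<^esub> r"
      have r': "r' \<in> carrier ?Fn" using u(1) r by (simp add: r'_def)
      have "\<psi> r' = \<zero>\<^bsub>P\<^esub>" using u r by (simp add: r'_def mod_homD(3)[OF \<psi>])
      then have "r' \<in> \<phi> ` carrier (free_on R {..<m})" unfolding ker using r' by (simp add: a_kernel_def')
      then obtain d where d: "d \<in> carrier (free_on R {..<m})" "r' = \<phi> d" by blast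
      have us: "u \<otimes>\<^bsub>R\<^esub> s \<in> S" using u s by simp
      obtain z' where z': "z' \<in> carrier ?Fa" "\<psi>' z' = Q.frac \<one>\<^bsub>R\<^esub> (u \<otimes>\<^bsub>R\<^esub> s)" using inv[OF us] by blast
      have \<tau>_c': "\<tau> r' z' \<in> carrier ?F" using mod_homD(1)[OF \<tau>1[OF r'] z'(1)] .
      have "\<tau> (\<phi> (unit_vec R {..<m} i)) z' \<in> H" if "i < m" for i
        by (rule R.free_on_hom_submodule[OF F H(1) \<tau>1[OF \<phi>_c(1)] _ z'(1)])
          (use that H(2) in \<open>auto simp: G_def\<close>)
      then have "\<tau> (\<phi> d) z' \<in> H"
        by (intro R.free_on_hom_submodule[OF F H(1) mod_hom_comp[OF \<phi> \<tau>2[OF z'(1)]] _ d(1)]) simp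
      then have \<tau>H: "\<tau> r' z' \<in> H" by (simp add: d)
      have "\<psi>' (row j c) = \<psi>' (row j (\<tau> r' z'))" if j: "j < n" for j
      proof -
        have "r' j = u \<otimes>\<^bsub>R\<^esub> r j" using j by (simp add: r'_def free_on_simps)
        moreover have "Q.frac (r j) s = Q.frac (u \<otimes>\<^bsub>R\<^esub> r j) (u \<otimes>\<^bsub>R\<^esub> s)"
          using rj[OF j] u s us by (intro Q.frac_eqI[of _ _ _ _ "\<one>\<^bsub>R\<^esub>"]) (auto simp: Q R.m_ac)
        ultimately show ?thesis using row_c[OF j] row_\<tau>'[OF j r' z' us] by simp
      qed
      from diff[OF H c(1) \<tau>_c' this] have "c \<ominus>\<^bsub>?F\<^esub> \<tau> r' z' \<oplus>\<^bsub>?F\<^esub> \<tau> r' z' \<in> H"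
        using \<tau>H F.submoduleE(5)[OF H(1)] by blast
      moreover have "c \<ominus>\<^bsub>?F\<^esub> \<tau> r' z' \<oplus>\<^bsub>?F\<^esub> \<tau> r' z' = c"
        using c(1) \<tau>_c' by (simp add: a_minus_def F.M.a_assoc F.M.l_neg)
      ultimately show "c \<in> H" by simp
    qed
  qed
qed

section \<open>Direct sums\<close>

lemma hom_ext_sum_module:
  assumes F: "module R F" and M: "\<And>i. i \<in> I \<Longrightarrow> module R (M i)" and K: "submodule K R F"
    and G: "finite G" "G \<subseteq> K" "\<And>H. submodule H R F \<Longrightarrow> G \<subseteq> H \<Longrightarrow> K \<subseteq> H"
    and ext: "\<And>i. i \<in> I \<Longrightarrow> hom_ext R F K (M i)"
  shows "hom_ext R F K (sum_module I M)"
  unfolding hom_ext_def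
proof
  interpret F: module R F by fact
  let ?K = "F\<lparr>carrier := K\<rparr>"
  note Kmod = submodule.submodule_is_module[OF K F]
  note K' = F.submoduleE[OF K]
  fix g assume g: "g \<in> mod_hom R ?K (sum_module I M)"
  have gi: "(\<lambda>a. g a i) \<in> mod_hom R ?K (M i)" if "i \<in> I" for i
    using that mod_homD[OF g] by (intro mod_homI) (auto simp: sum_module_def prod_module_def PiE_iff)
  define J where "J = (\<Union>a\<in>G. {i \<in> I. g a i \<noteq> \<zero>\<^bsub>M i\<^esub>})"
  have J: "finite J" "J \<subseteq> I"
    using G(1,2) mod_homD(1)[OF g] by (auto simp: J_def sum_module_def)
  \<comment> \<open>Each generator has a finite support under \<open>g\<close>, and \<open>J\<close>
    collects them. The elements of \<open>K\<close> whose values vanish outside \<open>J\<close>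
    form a submodule containing \<open>G\<close>, hence they are all of \<open>K\<close>.\<close>
  define H where "H = {a \<in> K. \<forall>i\<in>I - J. g a i = \<zero>\<^bsub>M i\<^esub>}"
  have "submodule H R F"
  proof (rule F.submoduleI)
    show "H \<subseteq> carrier F" using K' by (auto simp: H_def)
    have "\<zero>\<^bsub>F\<^esub> \<in> K" using K submodule.axioms(1) subgroup.one_closed by fastforce
    then show "\<zero>\<^bsub>F\<^esub> \<in> H" using mod_hom_zero[OF Kmod M gi] by (auto simp: H_def)
  next
    fix a assume a: "a \<in> H"
    then have aK: "a \<in> K" by (simp add: H_def)
    have "g (\<ominus>\<^bsub>F\<^esub> a) i = \<zero>\<^bsub>M i\<^esub>" if i: "i \<in> I - J" for i
    proof -
      interpret Mi: module R "M i" using M i by simp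
      have "g (\<ominus>\<^bsub>F\<^esub> a) i \<oplus>\<^bsub>M i\<^esub> g a i = g (\<ominus>\<^bsub>F\<^esub> a \<oplus>\<^bsub>F\<^esub> a) i"
        using mod_homD(2)[OF gi, of i "\<ominus>\<^bsub>F\<^esub> a" a] aK K'(3) i by simp
      also have "\<dots> = \<zero>\<^bsub>M i\<^esub>"
        using aK K'(1) mod_hom_zero[OF Kmod M gi] i by (simp add: F.M.l_neg subset_iff)
      finally show ?thesis
        using a i mod_homD(1)[OF gi, of i "\<ominus>\<^bsub>F\<^esub> a"] K'(3)[OF aK] by (simp add: H_def)
    qed
    then show "\<ominus>\<^bsub>F\<^esub> a \<in> H" using aK K'(3) by (simp add: H_def)
  next
    fix a b assume ab: "a \<in> H" "b \<in> H"
    have "g (a \<oplus>\<^bsub>F\<^esub> b) i = \<zero>\<^bsub>M i\<^esub>" if i: "i \<in> I - J" for i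
    proof -
      interpret Mi: module R "M i" using M i by simp
      show ?thesis using mod_homD(2)[OF gi, of i a b] ab i by (simp add: H_def)
    qed
    then show "a \<oplus>\<^bsub>F\<^esub> b \<in> H" using ab K'(5) by (simp add: H_def)
  next
    fix r a assume ra: "r \<in> carrier R" "a \<in> H"
    have "g (r \<odot>\<^bsub>F\<^esub> a) i = \<zero>\<^bsub>M i\<^esub>" if i: "i \<in> I - J" for i
    proof -
      interpret Mi: module R "M i" using M i by simp
      show ?thesis using mod_homD(3)[OF gi, of i r a] ra i by (simp add: H_def)
    qed
    then show "r \<odot>\<^bsub>F\<^esub> a \<in> H" using ra K'(4) by (simp add: H_def)
  qed
  moreover have "G \<subseteq> H" using G(2) by (auto simp: H_def J_def)
  ultimately have "K \<subseteq> H" by (rule G(3))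
  then have outside: "g a i = \<zero>\<^bsub>M i\<^esub>" if "a \<in> K" "i \<in> I - J" for a i using that by (auto simp: H_def)
  \<comment> \<open>Outside \<open>J\<close> the zero map is prescribed: an arbitrary extension of
    the zero map on \<open>K\<close> could be nonzero on \<open>F\<close>, and infinitely many such
    components would leave the direct sum.\<close>
  have "\<forall>i\<in>I. \<exists>b\<in>mod_hom R F (M i). (\<forall>a\<in>K. b a = g a i) \<and> (i \<notin> J \<longrightarrow> b = (\<lambda>_. \<zero>\<^bsub>M i\<^esub>))"
  proof
    fix i assume i: "i \<in> I"
    show "\<exists>b\<in>mod_hom R F (M i). (\<forall>a\<in>K. b a = g a i) \<and> (i \<notin> J \<longrightarrow> b = (\<lambda>_. \<zero>\<^bsub>M i\<^esub>))"
    proof (cases "i \<in> J")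
      case True
      then show ?thesis using bspec[OF ext[OF i, unfolded hom_ext_def] gi[OF i]] by auto
    next
      case False
      then show ?thesis
        using outside i by (intro bexI[OF _ mod_hom_zero_map[OF F M[OF i]]]) auto
    qed
  qed
  then obtain b where b: "\<And>i. i \<in> I \<Longrightarrow> b i \<in> mod_hom R F (M i)"
    "\<And>i a. i \<in> I \<Longrightarrow> a \<in> K \<Longrightarrow> b i a = g a i" "\<And>i. i \<in> I \<Longrightarrow> i \<notin> J \<Longrightarrow> b i = (\<lambda>_. \<zero>\<^bsub>M i\<^esub>)"
    by metis
  show "\<exists>b\<in>mod_hom R F (sum_module I M). \<forall>a\<in>K. b a = g a"
  proof (intro bexI ballI)
    have "b i a = \<zero>\<^bsub>M i\<^esub>" if "i \<in> I" "i \<notin> J" for i a using b(3)[OF that] by simp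
    then have "finite {i \<in> I. b i a \<noteq> \<zero>\<^bsub>M i\<^esub>}" for a
      by (intro finite_subset[OF _ J(1)]) blast
    then show "(\<lambda>a. \<lambda>i\<in>I. b i a) \<in> mod_hom R F (sum_module I M)"
      by (intro mod_homI) (auto simp: sum_module_def prod_module_def mod_homD[OF b(1)] cong: conj_cong)
    show "(\<lambda>i\<in>I. b i a) = g a" if "a \<in> K" for a
      using that b(2) mod_homD(1)[OF g, of a] by (auto simp: sum_module_def prod_module_def PiE_iff extensional_def)
  qed
qed

lemma S_FP_injective_sum_module:
  assumes R: "cring R" and S: "submonoid S R" and RS: "finitely_presented R (localization R S (regular_module R))"
    and fpi: "\<And>i. i \<in> I \<Longrightarrow> S_FP_injective R S (M i)"
  shows "S_FP_injective R S (sum_module I M)"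
proof -
  interpret cring R by fact
  have M: "module R (M i)" if "i \<in> I" for i using fpi[OF that] by (simp add: S_FP_injective_def)
  show ?thesis
  proof (rule S_FP_injectiveI[OF S sum_module_module[OF R M]])
    fix P :: "('a, (nat \<Rightarrow> 'a) set) module" assume P: "finitely_presented R P"
    let ?L = "localization R S P"
    have L: "module R ?L"
      using P S by (intro loc_module.localization_module) (simp add: loc_module_def finitely_presented_def)
    obtain X :: "(nat \<times> nat) set" and \<psi> G where \<psi>: "\<psi> \<in> mod_hom R (free_on R X) ?L"
      "\<psi> ` carrier (free_on R X) = carrier ?L" and G: "finite G" "G \<subseteq> a_kernel (free_on R X) ?L \<psi>"
      "\<And>H. submodule H R (free_on R X) \<Longrightarrow> G \<subseteq> H \<Longrightarrow> a_kernel (free_on R X) ?L \<psi> \<subseteq> H"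
      by (rule localization_fg_cover[OF S RS P]) (rule that)
    have "hom_ext R (free_on R X) (a_kernel (free_on R X) ?L \<psi>) (sum_module I M)"
      by (rule hom_ext_sum_module[OF free_on_module M submodule_kernel[OF free_on_module L \<psi>(1)] G
            S_FP_injective_hom_ext[OF S fpi P free_on_module \<psi>]])
    then show "\<exists>(X :: (nat \<times> nat) set) \<psi>. \<psi> \<in> mod_hom R (free_on R X) ?L \<and>
        \<psi> ` carrier (free_on R X) = carrier ?L \<and>
        hom_ext R (free_on R X) (a_kernel (free_on R X) ?L \<psi>) (sum_module I M)"
      by (intro exI[of _ X] exI[of _ \<psi>] conjI \<psi>)
  qed
qed

theorem proposition2p14:
  fixes R :: "('r, 'x) ring_scheme"
    and S :: "'r set"
    and I :: "'i set"
    and M :: "'i \<Rightarrow> ('r, 'm) module"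
  assumes "cring R"
    and "submonoid S R"
    and "\<zero>\<^bsub>R\<^esub> \<notin> S"
    and "\<And>i. i \<in> I \<Longrightarrow> module R (M i)"
  shows "((S_FP_injective R S (prod_module I M) \<longleftrightarrow> (\<forall>i\<in>I. S_FP_injective R S (M i)))
      \<and> (\<forall>(N :: ('r, 'n) module) A B.
            module R N \<and> S_FP_injective R S N
            \<and> submodule A R N \<and> submodule B R N
            \<and> A \<inter> B = {\<zero>\<^bsub>N\<^esub>} \<and> A <+>\<^bsub>N\<^esub> B = carrier N
            \<longrightarrow> S_FP_injective R S (N\<lparr>carrier := A\<rparr>)))
    \<and> (finitely_presented R (localization R S (regular_module R)) \<longrightarrow>
          (S_FP_injective R S (sum_module I M) \<longleftrightarrow> (\<forall>i\<in>I. S_FP_injective R S (M i))))"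
proof (intro conjI allI impI)
  note factor = S_FP_injective_factor[OF assms(1,2,4)]
  show "S_FP_injective R S (prod_module I M) \<longleftrightarrow> (\<forall>i\<in>I. S_FP_injective R S (M i))"
  proof
    assume "S_FP_injective R S (prod_module I M)"
    then show "\<forall>i\<in>I. S_FP_injective R S (M i)" by (intro ballI factor disjI1)
  next
    assume "\<forall>i\<in>I. S_FP_injective R S (M i)"
    then show "S_FP_injective R S (prod_module I M)" by (intro S_FP_injective_prod_module[OF assms(1,2)]) simp
  qed
  show "S_FP_injective R S (sum_module I M) \<longleftrightarrow> (\<forall>i\<in>I. S_FP_injective R S (M i))"
    if "finitely_presented R (localization R S (regular_module R))"
  proof
    assume "S_FP_injective R S (sum_module I M)"
    then show "\<forall>i\<in>I. S_FP_injective R S (M i)" by (intro ballI factor disjI2)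
  next
    assume "\<forall>i\<in>I. S_FP_injective R S (M i)"
    then show "S_FP_injective R S (sum_module I M)" by (intro S_FP_injective_sum_module[OF assms(1,2) that]) simp
  qed
next
  fix N :: "('r, 'n) module" and A B
  assume "module R N \<and> S_FP_injective R S N \<and> submodule A R N \<and> submodule B R N
    \<and> A \<inter> B = {\<zero>\<^bsub>N\<^esub>} \<and> A <+>\<^bsub>N\<^esub> B = carrier N"
  then show "S_FP_injective R S (N\<lparr>carrier := A\<rparr>)"
    by (elim conjE) (rule S_FP_injective_direct_summand[OF assms(2)])
qed

end
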